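(* Let $p$ be a prime, let $G$ be a finitely generated pro-$p$ group and let $K$ be an integer. Let $(X,G_\bullet)$ be a proper reduced finite graph of pro-$p$ groups whose pro-$p$ fundamental group $\Pi_1(X,G_\bullet)$ is isomorphic to $G$, and suppose that each edge group $G_e$ ($e\in EX$) has size at most $K$. Then $X$ has at most \[\frac{pK}{p-1}\,(\operatorname{rk}(G)-1)+1\] edges.
   Context: All homomorphisms between pro-$p$ groups are continuous. $\operatorname{rk}(G)$ denotes the minimal number of topological generators of the pro-$p$ group $G$; "finitely generated" means topologically finitely generated. A graph $X$ consists of a set $VX$ of vertices, a set $EX$ of edges and two functions $d_0,d_1\colon EX\to VX$ giving the endpoints of each edge; $x\in X$ means $x\in VX\cup EX$. Loops and multiple edges are allowed. Graphs of groups are over connected graphs. A (finite) graph of pro-$p$ groups $\mathcal G=(X,G_\bullet)$ consists of a finite connected graph $X$, a pro-$p$ group $G_x$ for each $x\in X$, and monomorphisms $\partial_{e,k}\colon G_e\to G_{d_k(e)}$ for each $e\in EX$ and $k=0,1$. It is reduced if $\partial_{e,k}$ is never an isomorphism when $e$ is not a loop. Fix a maximal subtree $T$ of $X$. A specialisation of $\mathcal G$ is a triple $(H,\nu_\bullet,t_\bullet)$ consisting of a pro-$p$ group $H$, morphisms $\nu_x\colon G_x\to H$ for each $x\in X$, and elements $t_e\in H$ for $e\in EX$, such that $t_e=1$ for all $e\in ET$ and $\nu_{d_0(e)}(\partial_{e,0}(g))=\nu_e(g)=t_e\,\nu_{d_1(e)}(\partial_{e,1}(g))\,t_e^{-1}$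 for all $e\in EX$, $g\in G_e$. The pro-$p$ fundamental group $\Pi_1(\mathcal G)=\Pi_1(X,G_\bullet)$ is the universal specialisation: a specialisation $(H,\nu_\bullet,t_\bullet)$ such that for any specialisation $(K',\beta_\bullet,t'_\bullet)$ there is a unique morphism $\phi\colon H\to K'$ with $\phi\nu_x=\beta_x$ for all $x\in X$ and $\phi(t_e)=t'_e$ for all $e\in EX$. It always exists and is independent of $T$ up to isomorphism. The maps $\nu_x$ need not be injective in general. $\mathcal G$ is proper if the natural maps $\nu_x\colon G_x\to\Pi_1(\mathcal G)$ are injective for all $x\in X$.
   Formalization: If X has no edges, it is additionally assumed that K ≥ 0 and that G is nontrivial; without this the claim fails, e.g. for a single vertex with G trivial and K = 1, where the bound is negative. Nothing is added when X has an edge. *)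

theory Defs
  imports
    "HOL-Analysis.Analysis"
    "HOL-Algebra.Generated_Groups"
    "HOL-Computational_Algebra.Primes"
    "Graph_Theory.Digraph_Component"
begin

section \<open>Pro-$p$ groups\<close>

record 'a top_group = "'a monoid" +
  gtop :: "'a topology"

definition topological_group :: "'a top_group \<Rightarrow> bool" where
  "topological_group G \<longleftrightarrow>
     Group.group G \<and> topspace (gtop G) = carrier G \<and>
     continuous_map (prod_topology (gtop G) (gtop G)) (gtop G) (\<lambda>(x, y). x \<otimes>\<^bsub>G\<^esub> y) \<and>
     continuous_map (gtop G) (gtop G) (\<lambda>x. inv\<^bsub>G\<^esub> x)"

text \<open>A profinite group, i.e. a compact Hausdorff group in which the open normal subgroups form a
  neighbourhood base of the identity, all of whose finite continuous quotients are $p$-groups.\<close>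

definition pro_p_group :: "nat \<Rightarrow> 'a top_group \<Rightarrow> bool" where
  "pro_p_group p G \<longleftrightarrow>
     topological_group G \<and> compact_space (gtop G) \<and> Hausdorff_space (gtop G) \<and>
     (\<forall>U. openin (gtop G) U \<and> \<one>\<^bsub>G\<^esub> \<in> U \<longrightarrow> (\<exists>N. N \<lhd> G \<and> openin (gtop G) N \<and> N \<subseteq> U)) \<and>
     (\<forall>N. N \<lhd> G \<and> openin (gtop G) N \<longrightarrow> (\<exists>n. order (G Mod N) = p ^ n))"

definition cont_hom :: "'a top_group \<Rightarrow> 'b top_group \<Rightarrow> ('a \<Rightarrow> 'b) set" where
  "cont_hom G H = {f \<in> hom G H. continuous_map (gtop G) (gtop H) f}"

definition top_iso :: "'a top_group \<Rightarrow> 'b top_group \<Rightarrow> ('a \<Rightarrow> 'b) set" where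
  "top_iso G H = {f \<in> iso G H. homeomorphic_map (gtop G) (gtop H) f}"

definition top_generates :: "'a top_group \<Rightarrow> 'a set \<Rightarrow> bool" where
  "top_generates G S \<longleftrightarrow> S \<subseteq> carrier G \<and> Abstract_Topology.closure_of (gtop G) (generate G S) = carrier G"

definition top_finitely_generated :: "'a top_group \<Rightarrow> bool" where
  "top_finitely_generated G \<longleftrightarrow> (\<exists>S. finite S \<and> top_generates G S)"

definition rk :: "'a top_group \<Rightarrow> nat" where
  "rk G = (LEAST n. \<exists>S. finite S \<and> card S = n \<and> top_generates G S)"


section \<open>Trees\<close>

text \<open>Graphs are the multidigraphs of \<^theory>\<open>Graph_Theory.Digraph\<close>, with
  $d_0 =$ \<^const>\<open>tail\<close> and $d_1 =$ \<^const>\<open>head\<close>; \<^const>\<open>Digraph_Component.connected\<close> ignores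
  orientations. The predicate \<^const>\<open>Digraph_Component.tree\<close> of that library excludes only
  \<^emph>\<open>directed\<close> cycles, so it is not usable here: a circuit below may traverse each edge in either
  direction (the Boolean is the direction), but no edge twice.\<close>

definition two_way :: "('v, 'e) pre_digraph \<Rightarrow> ('v, 'e \<times> bool) pre_digraph" where
  "two_way X = \<lparr>verts = verts X, arcs = arcs X \<times> UNIV,
     tail = (\<lambda>(e, b). if b then tail X e else head X e),
     head = (\<lambda>(e, b). if b then head X e else tail X e)\<rparr>"

definition circuit :: "('v, 'e) pre_digraph \<Rightarrow> ('e \<times> bool) list \<Rightarrow> bool" where
  "circuit X w \<longleftrightarrow>
     w \<noteq> [] \<and> distinct (map fst w) \<and> (\<exists>u. pre_digraph.awalk (two_way X) u w u)"

definition undirected_tree :: "('v, 'e) pre_digraph \<Rightarrow> bool" where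
  "undirected_tree X \<longleftrightarrow> Digraph_Component.connected X \<and> (\<nexists>w. circuit X w)"

definition maximal_subtree :: "('v, 'e) pre_digraph \<Rightarrow> ('v, 'e) pre_digraph \<Rightarrow> bool" where
  "maximal_subtree X T \<longleftrightarrow> pre_digraph.max_subgraph X undirected_tree T"


section \<open>Graphs of pro-$p$ groups\<close>

record ('v, 'e, 'a, 'b) graph_of_groups =
  base :: "('v, 'e) pre_digraph"
  vgroup :: "'v \<Rightarrow> 'a top_group"
  egroup :: "'e \<Rightarrow> 'b top_group"
  bd0 :: "'e \<Rightarrow> 'b \<Rightarrow> 'a"
  bd1 :: "'e \<Rightarrow> 'b \<Rightarrow> 'a"

definition graph_of_pro_p_groups :: "nat \<Rightarrow> ('v, 'e, 'a, 'b) graph_of_groups \<Rightarrow> bool" where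
  "graph_of_pro_p_groups p \<G> \<longleftrightarrow>
     fin_digraph (base \<G>) \<and> Digraph_Component.connected (base \<G>) \<and>
     (\<forall>v\<in>verts (base \<G>). pro_p_group p (vgroup \<G> v)) \<and>
     (\<forall>e\<in>arcs (base \<G>). pro_p_group p (egroup \<G> e) \<and>
        bd0 \<G> e \<in> cont_hom (egroup \<G> e) (vgroup \<G> (tail (base \<G>) e)) \<and>
        inj_on (bd0 \<G> e) (carrier (egroup \<G> e)) \<and>
        bd1 \<G> e \<in> cont_hom (egroup \<G> e) (vgroup \<G> (head (base \<G>) e)) \<and>
        inj_on (bd1 \<G> e) (carrier (egroup \<G> e)))"

definition reduced_graph_of_groups :: "('v, 'e, 'a, 'b) graph_of_groups \<Rightarrow> bool" where
  "reduced_graph_of_groups \<G> \<longleftrightarrow>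
     (\<forall>e\<in>arcs (base \<G>). tail (base \<G>) e \<noteq> head (base \<G>) e \<longrightarrow>
        bd0 \<G> e \<notin> top_iso (egroup \<G> e) (vgroup \<G> (tail (base \<G>) e)) \<and>
        bd1 \<G> e \<notin> top_iso (egroup \<G> e) (vgroup \<G> (head (base \<G>) e)))"

text \<open>The family $\nu_\bullet$ is split into its vertex part \<open>\<nu>V\<close> and its edge part \<open>\<nu>E\<close>.\<close>

definition specialisation ::
    "nat \<Rightarrow> ('v, 'e, 'a, 'b) graph_of_groups \<Rightarrow> ('v, 'e) pre_digraph \<Rightarrow>
     'h top_group \<Rightarrow> ('v \<Rightarrow> 'a \<Rightarrow> 'h) \<Rightarrow> ('e \<Rightarrow> 'b \<Rightarrow> 'h) \<Rightarrow> ('e \<Rightarrow> 'h) \<Rightarrow> bool" where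
  "specialisation p \<G> T H \<nu>V \<nu>E t \<longleftrightarrow>
     pro_p_group p H \<and>
     (\<forall>v\<in>verts (base \<G>). \<nu>V v \<in> cont_hom (vgroup \<G> v) H) \<and>
     (\<forall>e\<in>arcs (base \<G>). \<nu>E e \<in> cont_hom (egroup \<G> e) H \<and> t e \<in> carrier H) \<and>
     (\<forall>e\<in>arcs T. t e = \<one>\<^bsub>H\<^esub>) \<and>
     (\<forall>e\<in>arcs (base \<G>). \<forall>g\<in>carrier (egroup \<G> e).
        \<nu>V (tail (base \<G>) e) (bd0 \<G> e g) = \<nu>E e g \<and>
        \<nu>E e g = t e \<otimes>\<^bsub>H\<^esub> \<nu>V (head (base \<G>) e) (bd1 \<G> e g) \<otimes>\<^bsub>H\<^esub> inv\<^bsub>H\<^esub> (t e))"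

definition spec_morphism ::
    "('v, 'e, 'a, 'b) graph_of_groups \<Rightarrow>
     'h top_group \<Rightarrow> ('v \<Rightarrow> 'a \<Rightarrow> 'h) \<Rightarrow> ('e \<Rightarrow> 'b \<Rightarrow> 'h) \<Rightarrow> ('e \<Rightarrow> 'h) \<Rightarrow>
     'k top_group \<Rightarrow> ('v \<Rightarrow> 'a \<Rightarrow> 'k) \<Rightarrow> ('e \<Rightarrow> 'b \<Rightarrow> 'k) \<Rightarrow> ('e \<Rightarrow> 'k) \<Rightarrow>
     ('h \<Rightarrow> 'k) \<Rightarrow> bool" where
  "spec_morphism \<G> H \<nu>V \<nu>E t K \<beta>V \<beta>E s \<phi> \<longleftrightarrow>
     \<phi> \<in> cont_hom H K \<and>
     (\<forall>v\<in>verts (base \<G>). \<forall>g\<in>carrier (vgroup \<G> v). \<phi> (\<nu>V v g) = \<beta>V v g) \<and>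
     (\<forall>e\<in>arcs (base \<G>). \<forall>g\<in>carrier (egroup \<G> e). \<phi> (\<nu>E e g) = \<beta>E e g) \<and>
     (\<forall>e\<in>arcs (base \<G>). \<phi> (t e) = s e)"

text \<open>A definition cannot quantify over all types, so the target \<open>K\<close> of the universal property is
  taken with carrier in a type of the cardinality of the continuum, which accommodates all
  finitely generated pro-$p$ groups. This loses nothing:
  the lemma \<open>universal_property\<close> below derives the
  universal property for targets \<open>K\<close> of an arbitrary type.\<close>

definition pro_p_fundamental_group ::
    "nat \<Rightarrow> ('v, 'e, 'a, 'b) graph_of_groups \<Rightarrow> ('v, 'e) pre_digraph \<Rightarrow>
     'h top_group \<Rightarrow> ('v \<Rightarrow> 'a \<Rightarrow> 'h) \<Rightarrow> ('e \<Rightarrow> 'b \<Rightarrow> 'h) \<Rightarrow> ('e \<Rightarrow> 'h) \<Rightarrow> bool" where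
  "pro_p_fundamental_group p \<G> T H \<nu>V \<nu>E t \<longleftrightarrow>
     specialisation p \<G> T H \<nu>V \<nu>E t \<and>
     (\<forall>(K :: nat set top_group) \<beta>V \<beta>E s. specialisation p \<G> T K \<beta>V \<beta>E s \<longrightarrow>
        (\<exists>\<phi>. spec_morphism \<G> H \<nu>V \<nu>E t K \<beta>V \<beta>E s \<phi> \<and>
             (\<forall>\<psi>. spec_morphism \<G> H \<nu>V \<nu>E t K \<beta>V \<beta>E s \<psi> \<longrightarrow>
                  (\<forall>h\<in>carrier H. \<psi> h = \<phi> h))))"

text \<open>Properness of \<open>\<G>\<close>, expressed for the natural maps \<open>\<nu>V\<close>, \<open>\<nu>E\<close> into a pro-$p$ fundamental
  group of \<open>\<G>\<close>.\<close>

definition proper ::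
    "('v, 'e, 'a, 'b) graph_of_groups \<Rightarrow> ('v \<Rightarrow> 'a \<Rightarrow> 'h) \<Rightarrow> ('e \<Rightarrow> 'b \<Rightarrow> 'h) \<Rightarrow> bool" where
  "proper \<G> \<nu>V \<nu>E \<longleftrightarrow>
     (\<forall>v\<in>verts (base \<G>). inj_on (\<nu>V v) (carrier (vgroup \<G> v))) \<and>
     (\<forall>e\<in>arcs (base \<G>). inj_on (\<nu>E e) (carrier (egroup \<G> e)))"

section \<open>The universal property for targets of arbitrary type\<close>

lemma pro_p_groupD:
  assumes "pro_p_group p G"
  shows "Group.group G" "topspace (gtop G) = carrier G" "compact_space (gtop G)" "Hausdorff_space (gtop G)"
    "continuous_map (prod_topology (gtop G) (gtop G)) (gtop G) (\<lambda>(x, y). x \<otimes>\<^bsub>G\<^esub> y)"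
  using assms by (auto simp: pro_p_group_def topological_group_def)

lemma continuous_map_ltranslate:
  assumes "pro_p_group p G" "a \<in> carrier G"
  shows "continuous_map (gtop G) (gtop G) (\<lambda>x. a \<otimes>\<^bsub>G\<^esub> x)"
proof -
  have "continuous_map (gtop G) (prod_topology (gtop G) (gtop G)) (\<lambda>x. (a, x))"
    using assms by (intro continuous_map_pairedI) (auto simp: pro_p_groupD(2))
  from continuous_map_compose[OF this pro_p_groupD(5)[OF assms(1)]] show ?thesis
    by (simp add: o_def)
qed

lemma finite_quotient:
  fixes K :: "'k top_group"
  assumes p: "prime p" and K: "pro_p_group p K" and N: "N \<lhd> K" "openin (gtop K) N"
  obtains Q :: "nat set top_group" and g where
    "pro_p_group p Q" "gtop Q = discrete_topology (carrier Q)" "g \<in> cont_hom K Q"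
    "g ` carrier K = carrier Q" "\<And>x. x \<in> carrier K \<Longrightarrow> g x = \<one>\<^bsub>Q\<^esub> \<longleftrightarrow> x \<in> N"
proof -
  interpret K: Group.group K using pro_p_groupD[OF K] by simp
  interpret N: normal N K by fact
  let ?M = "K Mod N"
  interpret M: Group.group ?M by (rule N.factorgroup_is_group)
  obtain n where n: "order ?M = p ^ n" using K N by (auto simp: pro_p_group_def)
  have pp: "p > 0" using p by (rule prime_gt_0_nat)
  have finM: "finite (carrier ?M)" using n pp by (metis card.infinite order_def power_eq_0_iff less_irrefl)
  obtain f :: "'k set \<Rightarrow> nat set" where f: "inj_on f (carrier ?M)"
  proof -
    obtain f0 :: "'k set \<Rightarrow> nat" where "inj_on f0 (carrier ?M)"
      using finM finite_imp_inj_to_nat_seg by metis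
    then have "inj_on (\<lambda>x. {f0 x}) (carrier ?M)" by (auto simp: inj_on_def)
    then show ?thesis by (rule that)
  qed
  define h where "h = the_inv_into (carrier ?M) f"
  have hf[simp]: "h (f x) = x" if "x \<in> carrier ?M" for x
    unfolding h_def using that f by (simp add: the_inv_into_f_f)
  define Q :: "nat set top_group" where
    "Q = \<lparr>carrier = f ` carrier ?M, monoid.mult = (\<lambda>a b. f (h a \<otimes>\<^bsub>?M\<^esub> h b)), one = f \<one>\<^bsub>?M\<^esub>,
          gtop = discrete_topology (f ` carrier ?M)\<rparr>"
  have Qs: "carrier Q = f ` carrier ?M" "\<one>\<^bsub>Q\<^esub> = f \<one>\<^bsub>?M\<^esub>"
    "\<And>a b. a \<otimes>\<^bsub>Q\<^esub> b = f (h a \<otimes>\<^bsub>?M\<^esub> h b)" "gtop Q = discrete_topology (carrier Q)"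
    by (simp_all add: Q_def)
  have gQ: "Group.group Q"
  proof (rule groupI)
    fix x assume "x \<in> carrier Q"
    then obtain a where a: "a \<in> carrier ?M" "x = f a" by (auto simp: Qs)
    show "\<exists>y\<in>carrier Q. y \<otimes>\<^bsub>Q\<^esub> x = \<one>\<^bsub>Q\<^esub>"
      using a M.inv_closed[OF a(1)] M.l_inv[OF a(1)]
      by (intro bexI[of _ "f (inv\<^bsub>?M\<^esub> a)"]) (simp_all add: Qs del: one_FactGroup mult_FactGroup)
  qed (auto simp: Qs M.m_assoc simp del: one_FactGroup mult_FactGroup)
  interpret Q: Group.group Q by fact
  have orderQ: "order Q = p ^ n" using n f by (simp add: order_def Qs card_image)
  have ppQ: "pro_p_group p Q"
    unfolding pro_p_group_def topological_group_def
  proof (intro conjI allI impI)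
    show "continuous_map (prod_topology (gtop Q) (gtop Q)) (gtop Q) (\<lambda>(x, y). x \<otimes>\<^bsub>Q\<^esub> y)"
      by (auto simp: Qs(4) prod_topology_discrete_topology[symmetric] Q.m_closed)
    show "\<exists>N. N \<lhd> Q \<and> openin (gtop Q) N \<and> N \<subseteq> U" if "openin (gtop Q) U \<and> \<one>\<^bsub>Q\<^esub> \<in> U" for U
      using that Q.one_is_normal by (intro exI[of _ "{\<one>\<^bsub>Q\<^esub>}"]) (auto simp: Qs(4))
    show "\<exists>n. order (Q Mod N) = p ^ n" if "N \<lhd> Q \<and> openin (gtop Q) N" for N
    proof -
      have "subgroup N Q" using that by (simp add: normal_imp_subgroup)
      from Q.lagrange[OF this] have "card (rcosets\<^bsub>Q\<^esub> N) dvd p ^ n"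
        using orderQ by (metis dvd_triv_left)
      then show ?thesis using p by (auto simp: order_def FactGroup_def divides_primepow_nat)
    qed
    show "continuous_map (gtop Q) (gtop Q) (\<lambda>x. inv\<^bsub>Q\<^esub> x)"
      by (auto simp: Qs(4))
  qed (use gQ finM in \<open>auto simp: Qs(4) Qs(1) compact_space_discrete_topology\<close>)
  define g where "g = (\<lambda>x. f (N #>\<^bsub>K\<^esub> x))"
  have cos: "N #>\<^bsub>K\<^esub> x \<in> carrier ?M" if "x \<in> carrier K" for x
    using that by (auto simp: FactGroup_def RCOSETS_def)
  have gcar: "g x \<in> carrier Q" if "x \<in> carrier K" for x
    using that cos by (auto simp: g_def Qs)
  have ghom: "g \<in> hom K Q"
    using gcar cos by (auto simp: hom_def g_def Qs(3) N.rcos_sum)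
  have gone: "g x = \<one>\<^bsub>Q\<^esub> \<longleftrightarrow> x \<in> N" if "x \<in> carrier K" for x
  proof -
    have "g x = \<one>\<^bsub>Q\<^esub> \<longleftrightarrow> N #>\<^bsub>K\<^esub> x = N"
      using inj_on_eq_iff[OF f cos[OF that] M.one_closed] by (simp add: g_def Qs)
    also have "\<dots> \<longleftrightarrow> x \<in> N"
      using that K.coset_join1 K.coset_join2 N.subgroup_axioms N.subset by metis
    finally show ?thesis .
  qed
  have gK: "g ` carrier K = carrier Q"
    by (auto simp: g_def Qs FactGroup_def RCOSETS_def)
  have "continuous_map (gtop K) (gtop Q) g"
    unfolding continuous_map_def
  proof (intro conjI allI impI)
    show "g \<in> topspace (gtop K) \<rightarrow> topspace (gtop Q)"
      using gcar by (auto simp: Qs(4) pro_p_groupD(2)[OF K])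
    fix U assume "openin (gtop Q) U"
    show "openin (gtop K) {x \<in> topspace (gtop K). g x \<in> U}"
    proof (subst openin_subopen, intro ballI)
      fix x assume "x \<in> {x \<in> topspace (gtop K). g x \<in> U}"
      then have x: "x \<in> carrier K" "g x \<in> U" by (auto simp: pro_p_groupD(2)[OF K])
      let ?V = "{y \<in> topspace (gtop K). inv\<^bsub>K\<^esub> x \<otimes>\<^bsub>K\<^esub> y \<in> N}"
      have "openin (gtop K) ?V"
        using openin_continuous_map_preimage[OF continuous_map_ltranslate[OF K] N(2)] x by simp
      moreover have "x \<in> ?V" using x by (simp add: pro_p_groupD(2)[OF K])
      moreover have "?V \<subseteq> {x \<in> topspace (gtop K). g x \<in> U}"
      proof
        fix y assume "y \<in> ?V"
        then have y: "y \<in> carrier K" "inv\<^bsub>K\<^esub> x \<otimes>\<^bsub>K\<^esub> y \<in> N" by (auto simp: pro_p_groupD(2)[OF K])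
        have "g y = g (x \<otimes>\<^bsub>K\<^esub> (inv\<^bsub>K\<^esub> x \<otimes>\<^bsub>K\<^esub> y))"
          using x y by (simp add: K.m_assoc[symmetric])
        also have "\<dots> = g x \<otimes>\<^bsub>Q\<^esub> g (inv\<^bsub>K\<^esub> x \<otimes>\<^bsub>K\<^esub> y)"
          using x y ghom by (simp add: hom_mult)
        also have "\<dots> = g x" using gone[of "inv\<^bsub>K\<^esub> x \<otimes>\<^bsub>K\<^esub> y"] x y gcar by simp
        finally show "y \<in> {x \<in> topspace (gtop K). g x \<in> U}"
          using x y by (simp add: pro_p_groupD(2)[OF K])
      qed
      ultimately show "\<exists>T. openin (gtop K) T \<and> x \<in> T \<and> T \<subseteq> {x \<in> topspace (gtop K). g x \<in> U}"
        by blast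
    qed
  qed
  then have "g \<in> cont_hom K Q" using ghom by (simp add: cont_hom_def)
  from that[OF ppQ Qs(4) this gK gone] show ?thesis .
qed

lemma cont_hom_compose:
  "f \<in> cont_hom A B \<Longrightarrow> g \<in> cont_hom B C \<Longrightarrow> (\<lambda>x. g (f x)) \<in> cont_hom A C"
  unfolding cont_hom_def
  by (auto simp: hom_def Pi_iff dest: continuous_map_compose[of _ _ f _ g] simp: o_def)

lemma cont_homD:
  "f \<in> cont_hom A B \<Longrightarrow> x \<in> carrier A \<Longrightarrow> f x \<in> carrier B"
  "f \<in> cont_hom A B \<Longrightarrow> x \<in> carrier A \<Longrightarrow> y \<in> carrier A \<Longrightarrow> f (x \<otimes>\<^bsub>A\<^esub> y) = f x \<otimes>\<^bsub>B\<^esub> f y"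
  "f \<in> cont_hom A B \<Longrightarrow> continuous_map (gtop A) (gtop B) f"
  by (auto simp: cont_hom_def hom_def Pi_iff)

lemma cont_hom_group:
  assumes "f \<in> cont_hom A B" "Group.group A" "Group.group B"
  shows "f \<one>\<^bsub>A\<^esub> = \<one>\<^bsub>B\<^esub>" "x \<in> carrier A \<Longrightarrow> f (inv\<^bsub>A\<^esub> x) = inv\<^bsub>B\<^esub> (f x)"
proof -
  interpret group_hom A B f
    using assms by (simp add: group_hom_def group_hom_axioms_def cont_hom_def)
  show "f \<one>\<^bsub>A\<^esub> = \<one>\<^bsub>B\<^esub>" "x \<in> carrier A \<Longrightarrow> f (inv\<^bsub>A\<^esub> x) = inv\<^bsub>B\<^esub> (f x)" by auto
qed

lemma specialisation_compose:
  assumes \<G>: "graph_of_pro_p_groups p \<G>" and T: "arcs T \<subseteq> arcs (base \<G>)"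
    and S: "specialisation p \<G> T K \<beta>V \<beta>E s" and Q: "pro_p_group p Q" and g: "g \<in> cont_hom K Q"
  shows "specialisation p \<G> T Q (\<lambda>v x. g (\<beta>V v x)) (\<lambda>e x. g (\<beta>E e x)) (\<lambda>e. g (s e))"
proof -
  have K: "pro_p_group p K" using S by (simp add: specialisation_def)
  interpret K: Group.group K using pro_p_groupD[OF K] by simp
  note grp = pro_p_groupD(1)[OF K] pro_p_groupD(1)[OF Q]
  have fin: "wf_digraph (base \<G>)"
    using \<G> by (simp add: graph_of_pro_p_groups_def fin_digraph_def)
  note gh = cont_homD(1,2)[OF g] cont_hom_group[OF g grp]
  have main: "g (\<beta>V (tail (base \<G>) e) (bd0 \<G> e x)) = g (\<beta>E e x)"
    "g (\<beta>E e x) = g (s e) \<otimes>\<^bsub>Q\<^esub> g (\<beta>V (head (base \<G>) e) (bd1 \<G> e x)) \<otimes>\<^bsub>Q\<^esub> inv\<^bsub>Q\<^esub> (g (s e))"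
    if e: "e \<in> arcs (base \<G>)" and x: "x \<in> carrier (egroup \<G> e)" for e x
  proof -
    show "g (\<beta>V (tail (base \<G>) e) (bd0 \<G> e x)) = g (\<beta>E e x)"
      using S e x by (simp add: specialisation_def)
    have 1: "\<beta>E e x = s e \<otimes>\<^bsub>K\<^esub> \<beta>V (head (base \<G>) e) (bd1 \<G> e x) \<otimes>\<^bsub>K\<^esub> inv\<^bsub>K\<^esub> (s e)"
      using S e x by (auto simp: specialisation_def)
    have 2: "bd1 \<G> e x \<in> carrier (vgroup \<G> (head (base \<G>) e))"
      using \<G> e x cont_homD(1) by (fastforce simp: graph_of_pro_p_groups_def)
    have "\<beta>V (head (base \<G>) e) \<in> cont_hom (vgroup \<G> (head (base \<G>) e)) K"
      using S wf_digraph.head_in_verts[OF fin e] by (simp add: specialisation_def)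
    then have 3: "\<beta>V (head (base \<G>) e) (bd1 \<G> e x) \<in> carrier K"
      using 2 by (rule cont_homD)
    have 4: "s e \<in> carrier K" using S e by (simp add: specialisation_def)
    show "g (\<beta>E e x) = g (s e) \<otimes>\<^bsub>Q\<^esub> g (\<beta>V (head (base \<G>) e) (bd1 \<G> e x)) \<otimes>\<^bsub>Q\<^esub> inv\<^bsub>Q\<^esub> (g (s e))"
      unfolding 1 using 3 4 by (simp add: gh)
  qed
  show ?thesis
    unfolding specialisation_def
    using S Q g main gh by (auto simp: specialisation_def intro: cont_hom_compose)
qed

lemma spec_morphism_compose:
  assumes "spec_morphism \<G> H \<nu>V \<nu>E t K \<beta>V \<beta>E s \<phi>" "g \<in> cont_hom K Q"
  shows "spec_morphism \<G> H \<nu>V \<nu>E t Q (\<lambda>v x. g (\<beta>V v x)) (\<lambda>e x. g (\<beta>E e x)) (\<lambda>e. g (s e))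
           (\<lambda>x. g (\<phi> x))"
  using assms by (auto simp: spec_morphism_def intro: cont_hom_compose)

theorem universal_property:
  fixes K :: "'k top_group"
  assumes p: "prime p" and \<G>: "graph_of_pro_p_groups p \<G>" and T: "maximal_subtree (base \<G>) T"
    and H: "pro_p_fundamental_group p \<G> T H \<nu>V \<nu>E t"
    and K: "specialisation p \<G> T K \<beta>V \<beta>E s"
  shows "\<exists>\<phi>. spec_morphism \<G> H \<nu>V \<nu>E t K \<beta>V \<beta>E s \<phi> \<and>
           (\<forall>\<psi>. spec_morphism \<G> H \<nu>V \<nu>E t K \<beta>V \<beta>E s \<psi> \<longrightarrow> (\<forall>h\<in>carrier H. \<psi> h = \<phi> h))"
proof -
  have sT: "arcs T \<subseteq> arcs (base \<G>)"
    using T by (auto simp: maximal_subtree_def pre_digraph.max_subgraph_def subgraph_def)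
  have wf: "wf_digraph (base \<G>)"
    using \<G> by (simp add: graph_of_pro_p_groups_def fin_digraph_def)
  have ppK: "pro_p_group p K" using K by (simp add: specialisation_def)
  have HS: "specialisation p \<G> T H \<nu>V \<nu>E t" using H by (simp add: pro_p_fundamental_group_def)
  have ppH: "pro_p_group p H" using HS by (simp add: specialisation_def)
  interpret K: Group.group K using pro_p_groupD[OF ppK] by simp
  interpret H: Group.group H using pro_p_groupD[OF ppH] by simp
  note tK = pro_p_groupD(2)[OF ppK]
  note tH = pro_p_groupD(2)[OF ppH]
  define \<N> where "\<N> = {N. N \<lhd> K \<and> openin (gtop K) N}"
  have "\<exists>(Q :: nat set top_group) g. pro_p_group p Q \<and> gtop Q = discrete_topology (carrier Q) \<and>
      g \<in> cont_hom K Q \<and> g ` carrier K = carrier Q \<and> (\<forall>x\<in>carrier K. g x = \<one>\<^bsub>Q\<^esub> \<longleftrightarrow> x \<in> N)"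
    if "N \<in> \<N>" for N
    using that finite_quotient[OF p ppK, of N thesis for thesis] unfolding \<N>_def by (smt (verit) mem_Collect_eq)
  then have "\<forall>N\<in>\<N>. \<exists>Qg :: nat set top_group \<times> ('k \<Rightarrow> nat set).
      pro_p_group p (fst Qg) \<and> gtop (fst Qg) = discrete_topology (carrier (fst Qg)) \<and>
      snd Qg \<in> cont_hom K (fst Qg) \<and> snd Qg ` carrier K = carrier (fst Qg) \<and>
      (\<forall>x\<in>carrier K. snd Qg x = \<one>\<^bsub>fst Qg\<^esub> \<longleftrightarrow> x \<in> N)"
    by (simp only: split_paired_Ex fst_conv snd_conv) blast
  from bchoice[OF this] obtain Qg :: "'k set \<Rightarrow> nat set top_group \<times> ('k \<Rightarrow> nat set)" where Qg0:
    "\<forall>N\<in>\<N>. pro_p_group p (fst (Qg N)) \<and> gtop (fst (Qg N)) = discrete_topology (carrier (fst (Qg N))) \<and>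
      snd (Qg N) \<in> cont_hom K (fst (Qg N)) \<and> snd (Qg N) ` carrier K = carrier (fst (Qg N)) \<and>
      (\<forall>x\<in>carrier K. snd (Qg N) x = \<one>\<^bsub>fst (Qg N)\<^esub> \<longleftrightarrow> x \<in> N)" ..
  define Q where "Q = (\<lambda>N. fst (Qg N))"
  define g where "g = (\<lambda>N. snd (Qg N))"
  have Qg:
    "\<And>N. N \<in> \<N> \<Longrightarrow> pro_p_group p (Q N)"
    "\<And>N. N \<in> \<N> \<Longrightarrow> gtop (Q N) = discrete_topology (carrier (Q N))"
    "\<And>N. N \<in> \<N> \<Longrightarrow> g N \<in> cont_hom K (Q N)"
    "\<And>N. N \<in> \<N> \<Longrightarrow> g N ` carrier K = carrier (Q N)"
    "\<And>N x. N \<in> \<N> \<Longrightarrow> x \<in> carrier K \<Longrightarrow> g N x = \<one>\<^bsub>Q N\<^esub> \<longleftrightarrow> x \<in> N"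
    using Qg0 by (simp_all only: Q_def g_def)
  have gQ: "Group.group (Q N)" if "N \<in> \<N>" for N using pro_p_groupD(1)[OF Qg(1)[OF that]] .
  have geq: "g N x = g N y \<longleftrightarrow> inv\<^bsub>K\<^esub> x \<otimes>\<^bsub>K\<^esub> y \<in> N"
    if N: "N \<in> \<N>" and x: "x \<in> carrier K" and y: "y \<in> carrier K" for N x y
  proof -
    interpret Q: Group.group "Q N" by (rule gQ[OF N])
    note gN = Qg(3)[OF N]
    have cl: "g N x \<in> carrier (Q N)" "g N y \<in> carrier (Q N)"
      using cont_homD(1)[OF gN] x y by auto
    have "inv\<^bsub>K\<^esub> x \<otimes>\<^bsub>K\<^esub> y \<in> N \<longleftrightarrow> g N (inv\<^bsub>K\<^esub> x \<otimes>\<^bsub>K\<^esub> y) = \<one>\<^bsub>Q N\<^esub>"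
      using Qg(5)[OF N] x y by simp
    also have "g N (inv\<^bsub>K\<^esub> x \<otimes>\<^bsub>K\<^esub> y) = inv\<^bsub>Q N\<^esub> (g N x) \<otimes>\<^bsub>Q N\<^esub> g N y"
      using cont_homD(2)[OF gN] cont_hom_group(2)[OF gN K.group_axioms Q.group_axioms] x y by simp
    also have "\<dots> = \<one>\<^bsub>Q N\<^esub> \<longleftrightarrow> g N x = g N y"
      using cl by (metis Q.inv_closed Q.inv_equality Q.inv_inv Q.l_inv)
    finally show ?thesis by simp
  qed
  have base: "\<exists>N\<in>\<N>. N \<subseteq> U" if "openin (gtop K) U" "\<one>\<^bsub>K\<^esub> \<in> U" for U
    using ppK that unfolding pro_p_group_def \<N>_def by blast
  have sep: "x = y" if x: "x \<in> carrier K" and y: "y \<in> carrier K"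
    and eq: "\<And>N. N \<in> \<N> \<Longrightarrow> g N x = g N y" for x y
  proof (rule ccontr)
    assume "x \<noteq> y"
    let ?z = "inv\<^bsub>K\<^esub> x \<otimes>\<^bsub>K\<^esub> y"
    have z: "?z \<in> carrier K" "?z \<noteq> \<one>\<^bsub>K\<^esub>"
      using x y \<open>x \<noteq> y\<close> by (auto, metis K.inv_closed K.inv_equality K.inv_inv)
    then obtain U V where UV: "openin (gtop K) U" "\<one>\<^bsub>K\<^esub> \<in> U" "?z \<in> V" "disjnt U V"
      using pro_p_groupD(4)[OF ppK] K.one_closed unfolding Hausdorff_space_def tK by metis
    obtain N where "N \<in> \<N>" "N \<subseteq> U" using base UV by blast
    then show False using eq[of N] geq[of N x y] x y UV by (auto simp: disjnt_iff)
  qed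
  let ?spec = "\<lambda>N. spec_morphism \<G> H \<nu>V \<nu>E t (Q N) (\<lambda>v x. g N (\<beta>V v x)) (\<lambda>e x. g N (\<beta>E e x)) (\<lambda>e. g N (s e))"
  have uni: "\<exists>\<phi>. ?spec N \<phi> \<and> (\<forall>\<psi>. ?spec N \<psi> \<longrightarrow> (\<forall>h\<in>carrier H. \<psi> h = \<phi> h))" if N: "N \<in> \<N>" for N
    using H specialisation_compose[OF \<G> sT K Qg(1)[OF N] Qg(3)[OF N]]
    unfolding pro_p_fundamental_group_def by blast
  then obtain \<phi>N where \<phi>N: "\<And>N. N \<in> \<N> \<Longrightarrow> ?spec N (\<phi>N N)"
    "\<And>N \<psi> h. N \<in> \<N> \<Longrightarrow> ?spec N \<psi> \<Longrightarrow> h \<in> carrier H \<Longrightarrow> \<psi> h = \<phi>N N h"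
    by metis
  have \<phi>Nh: "\<phi>N N \<in> cont_hom H (Q N)" if "N \<in> \<N>" for N
    using \<phi>N(1)[OF that] by (simp add: spec_morphism_def)
  have compat: "g N x = \<phi>N N h"
    if M: "M \<in> \<N>" and N: "N \<in> \<N>" and MN: "M \<subseteq> N" and h: "h \<in> carrier H" and x: "x \<in> carrier K"
      and eq: "g M x = \<phi>N M h" for M N x h
  proof -
    interpret QN: Group.group "Q N" by (rule gQ[OF N])
    define r where "r = (\<lambda>a. SOME x. x \<in> carrier K \<and> g M x = a)"
    have r: "r a \<in> carrier K \<and> g M (r a) = a" if "a \<in> carrier (Q M)" for a
    proof -
      have "\<exists>x. x \<in> carrier K \<and> g M x = a" using that Qg(4)[OF M] by (metis imageE)
      then show ?thesis unfolding r_def by (rule someI_ex)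
    qed
    define \<theta> where "\<theta> = (\<lambda>a. g N (r a))"
    have \<theta>: "\<theta> (g M y) = g N y" if y: "y \<in> carrier K" for y
    proof -
      have 1: "g M y \<in> carrier (Q M)" using cont_homD(1)[OF Qg(3)[OF M]] y by simp
      have "inv\<^bsub>K\<^esub> (r (g M y)) \<otimes>\<^bsub>K\<^esub> y \<in> M" using r[OF 1] geq[OF M] y by metis
      then have "inv\<^bsub>K\<^esub> (r (g M y)) \<otimes>\<^bsub>K\<^esub> y \<in> N" using MN by auto
      then show ?thesis using r[OF 1] geq[OF N] y unfolding \<theta>_def by metis
    qed
    have \<theta>car: "\<theta> a \<in> carrier (Q N)" if "a \<in> carrier (Q M)" for a
      using r[OF that] cont_homD(1)[OF Qg(3)[OF N]] by (simp add: \<theta>_def)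
    have \<theta>mult: "\<theta> (a \<otimes>\<^bsub>Q M\<^esub> b) = \<theta> a \<otimes>\<^bsub>Q N\<^esub> \<theta> b"
      if "a \<in> carrier (Q M)" "b \<in> carrier (Q M)" for a b
    proof -
      have "\<theta> (a \<otimes>\<^bsub>Q M\<^esub> b) = \<theta> (g M (r a \<otimes>\<^bsub>K\<^esub> r b))"
        using r that cont_homD(2)[OF Qg(3)[OF M]] by simp
      also have "\<dots> = g N (r a) \<otimes>\<^bsub>Q N\<^esub> g N (r b)"
        using r that \<theta> cont_homD(2)[OF Qg(3)[OF N]] by simp
      finally show ?thesis by (simp add: \<theta>_def)
    qed
    have \<theta>h: "\<theta> \<in> cont_hom (Q M) (Q N)"
      unfolding cont_hom_def
      using \<theta>car \<theta>mult by (auto simp: hom_def Qg(2)[OF M] Qg(2)[OF N])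
    have bV: "\<beta>V v y \<in> carrier K" if "v \<in> verts (base \<G>)" "y \<in> carrier (vgroup \<G> v)" for v y
      using K that cont_homD(1) by (fastforce simp: specialisation_def)
    have bE: "\<beta>E e y \<in> carrier K" if "e \<in> arcs (base \<G>)" "y \<in> carrier (egroup \<G> e)" for e y
      using K that cont_homD(1) by (fastforce simp: specialisation_def)
    have sc: "s e \<in> carrier K" if "e \<in> arcs (base \<G>)" for e
      using K that by (simp add: specialisation_def)
    have "?spec N (\<lambda>x. \<theta> (\<phi>N M x))"
      using spec_morphism_compose[OF \<phi>N(1)[OF M] \<theta>h] \<theta> bV bE sc
      by (simp add: spec_morphism_def)
    then have "\<theta> (\<phi>N M h) = \<phi>N N h" using \<phi>N(2)[OF N _ h] by blast
    then show ?thesis using \<theta>[OF x] eq by simp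
  qed
  obtain N0 where KN: "N0 \<in> \<N>"
    using base[of "carrier K"] openin_topspace[of "gtop K"] tK by auto
  have Nint: "M \<inter> N \<in> \<N>" if "M \<in> \<N>" "N \<in> \<N>" for M N
    using that K.normal_subgroup_intersect by (auto simp: \<N>_def)
  have "\<exists>x\<in>carrier K. \<forall>N\<in>\<N>. g N x = \<phi>N N h" if h: "h \<in> carrier H" for h
  proof -
    define C where "C = (\<lambda>N. {x \<in> topspace (gtop K). g N x \<in> {\<phi>N N h}})"
    have cl: "closedin (gtop K) (C N)" if "N \<in> \<N>" for N
      unfolding C_def
      using cont_homD(1)[OF \<phi>Nh[OF that] h]
      by (intro closedin_continuous_map_preimage[OF cont_homD(3)[OF Qg(3)[OF that]]]) (simp add: Qg(2)[OF that])
    have lower: "\<exists>M\<in>\<N>. \<forall>N\<in>\<F>. M \<subseteq> N" if "finite \<F>" "\<F> \<subseteq> \<N>" for \<F>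
      using that
    proof (induction \<F>)
      case empty then show ?case using KN by auto
    next
      case (insert N \<F>)
      then obtain M where "M \<in> \<N>" "\<forall>N\<in>\<F>. M \<subseteq> N" by auto
      then show ?case using Nint[of M N] insert.prems by (intro bexI[of _ "M \<inter> N"]) auto
    qed
    have fip: "\<Inter>\<C> \<noteq> {}" if fin: "finite \<C>" and sub: "\<C> \<subseteq> C ` \<N>" for \<C>
    proof -
      obtain \<F> where \<F>: "finite \<F>" "\<F> \<subseteq> \<N>" "\<C> = C ` \<F>"
        using finite_subset_image[OF fin sub] by blast
      obtain M where M: "M \<in> \<N>" "\<forall>N\<in>\<F>. M \<subseteq> N" using lower \<F> by blast
      obtain x where x: "x \<in> carrier K" "g M x = \<phi>N M h"
        using Qg(4)[OF M(1)] cont_homD(1)[OF \<phi>Nh[OF M(1)] h] by (metis imageE)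
      have "x \<in> C N" if "N \<in> \<F>" for N
        using compat[OF M(1) _ _ h x] that \<F> M(2) x by (auto simp: C_def tK)
      then show ?thesis using \<F> by blast
    qed
    have "\<Inter>(C ` \<N>) \<noteq> {}"
      using pro_p_groupD(3)[OF ppK] fip cl unfolding compact_space_fip by (smt (verit) imageE)
    then obtain x where x: "\<And>N. N \<in> \<N> \<Longrightarrow> x \<in> C N" by blast
    with KN have "x \<in> carrier K" by (auto simp: C_def tK)
    then show ?thesis using x by (auto simp: C_def)
  qed
  then obtain \<phi> where \<phi>: "\<And>h. h \<in> carrier H \<Longrightarrow> \<phi> h \<in> carrier K"
    "\<And>h N. h \<in> carrier H \<Longrightarrow> N \<in> \<N> \<Longrightarrow> g N (\<phi> h) = \<phi>N N h"
    by metis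
  have \<phi>mult: "\<phi> (x \<otimes>\<^bsub>H\<^esub> y) = \<phi> x \<otimes>\<^bsub>K\<^esub> \<phi> y" if "x \<in> carrier H" "y \<in> carrier H" for x y
    using that \<phi> by (intro sep) (auto simp: cont_homD(2)[OF Qg(3)] cont_homD(2)[OF \<phi>Nh])
  have \<phi>cont: "continuous_map (gtop H) (gtop K) \<phi>"
    unfolding continuous_map_def
  proof (intro conjI allI impI)
    show "\<phi> \<in> topspace (gtop H) \<rightarrow> topspace (gtop K)" using \<phi> by (auto simp: tH tK)
    fix U assume U: "openin (gtop K) U"
    show "openin (gtop H) {x \<in> topspace (gtop H). \<phi> x \<in> U}"
    proof (subst openin_subopen, intro ballI)
      fix h assume "h \<in> {x \<in> topspace (gtop H). \<phi> x \<in> U}"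
      then have h: "h \<in> carrier H" "\<phi> h \<in> U" by (auto simp: tH)
      let ?W = "{y \<in> topspace (gtop K). \<phi> h \<otimes>\<^bsub>K\<^esub> y \<in> U}"
      have "openin (gtop K) ?W"
        using openin_continuous_map_preimage[OF continuous_map_ltranslate[OF ppK] U] \<phi>(1)[OF h(1)] by simp
      moreover have "\<one>\<^bsub>K\<^esub> \<in> ?W" using \<phi>(1)[OF h(1)] h by (simp add: tK)
      ultimately obtain N where N: "N \<in> \<N>" "N \<subseteq> ?W" using base by blast
      let ?V = "{y \<in> topspace (gtop H). \<phi>N N y \<in> {\<phi>N N h}}"
      have "openin (gtop H) ?V"
        using cont_homD(1)[OF \<phi>Nh[OF N(1)] h(1)]
        by (intro openin_continuous_map_preimage[OF cont_homD(3)[OF \<phi>Nh[OF N(1)]]]) (simp add: Qg(2)[OF N(1)])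
      moreover have "h \<in> ?V" using h by (simp add: tH)
      moreover have "?V \<subseteq> {x \<in> topspace (gtop H). \<phi> x \<in> U}"
      proof
        fix y assume "y \<in> ?V"
        then have y: "y \<in> carrier H" "\<phi>N N y = \<phi>N N h" by (auto simp: tH)
        have "inv\<^bsub>K\<^esub> (\<phi> h) \<otimes>\<^bsub>K\<^esub> \<phi> y \<in> N"
          using geq[OF N(1) \<phi>(1)[OF h(1)] \<phi>(1)[OF y(1)]] \<phi>(2)[OF h(1) N(1)] \<phi>(2)[OF y(1) N(1)] y by simp
        then have "\<phi> h \<otimes>\<^bsub>K\<^esub> (inv\<^bsub>K\<^esub> (\<phi> h) \<otimes>\<^bsub>K\<^esub> \<phi> y) \<in> U" using N(2) by blast
        then show "y \<in> {x \<in> topspace (gtop H). \<phi> x \<in> U}"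
          using \<phi>(1)[OF h(1)] \<phi>(1)[OF y(1)] y by (simp add: K.m_assoc[symmetric] tH)
      qed
      ultimately show "\<exists>T. openin (gtop H) T \<and> h \<in> T \<and> T \<subseteq> {x \<in> topspace (gtop H). \<phi> x \<in> U}"
        by blast
    qed
  qed
  have \<phi>h: "\<phi> \<in> cont_hom H K" using \<phi> \<phi>mult \<phi>cont by (auto simp: cont_hom_def hom_def)
  have V: "\<phi> (\<nu>V v x) = \<beta>V v x" if v: "v \<in> verts (base \<G>)" and x: "x \<in> carrier (vgroup \<G> v)" for v x
  proof -
    have 0: "\<nu>V v \<in> cont_hom (vgroup \<G> v) H" "\<beta>V v \<in> cont_hom (vgroup \<G> v) K"
      using K HS v by (simp_all add: specialisation_def)
    have 1: "\<nu>V v x \<in> carrier H" "\<beta>V v x \<in> carrier K"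
      using cont_homD(1)[OF 0(1) x] cont_homD(1)[OF 0(2) x] by auto
    show ?thesis
      using 1 \<phi> \<phi>N(1) v x by (intro sep) (auto simp: spec_morphism_def)
  qed
  have E: "\<phi> (\<nu>E e x) = \<beta>E e x" if e: "e \<in> arcs (base \<G>)" and x: "x \<in> carrier (egroup \<G> e)" for e x
  proof -
    have 0: "\<nu>E e \<in> cont_hom (egroup \<G> e) H" "\<beta>E e \<in> cont_hom (egroup \<G> e) K"
      using K HS e by (simp_all add: specialisation_def)
    have 1: "\<nu>E e x \<in> carrier H" "\<beta>E e x \<in> carrier K"
      using cont_homD(1)[OF 0(1) x] cont_homD(1)[OF 0(2) x] by auto
    show ?thesis
      using 1 \<phi> \<phi>N(1) e x by (intro sep) (auto simp: spec_morphism_def)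
  qed
  have tt: "\<phi> (t e) = s e" if e: "e \<in> arcs (base \<G>)" for e
  proof -
    have 1: "t e \<in> carrier H" "s e \<in> carrier K"
      using K HS e by (auto simp: specialisation_def)
    show ?thesis
      using 1 \<phi> \<phi>N(1) e by (intro sep) (auto simp: spec_morphism_def)
  qed
  have ex: "spec_morphism \<G> H \<nu>V \<nu>E t K \<beta>V \<beta>E s \<phi>"
    using \<phi>h V E tt by (simp add: spec_morphism_def)
  have "\<psi> h = \<phi> h" if \<psi>: "spec_morphism \<G> H \<nu>V \<nu>E t K \<beta>V \<beta>E s \<psi>" and h: "h \<in> carrier H" for \<psi> h
  proof (rule sep)
    have "\<psi> \<in> cont_hom H K" using \<psi> by (simp add: spec_morphism_def)
    then show "\<psi> h \<in> carrier K" using h by (rule cont_homD)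
    show "\<phi> h \<in> carrier K" using \<phi> h by simp
    fix N assume N: "N \<in> \<N>"
    show "g N (\<psi> h) = g N (\<phi> h)"
      using \<phi>N(2)[OF N spec_morphism_compose[OF \<psi> Qg(3)[OF N]] h] \<phi>(2)[OF h N] by simp
  qed
  then show ?thesis using ex by blast
qed

end

theory Submission
  imports Defs
begin

text \<open>
  Since the edge groups are finite, \<open>\<nu>\<close> is injective and \<open>\<G>\<close> is reduced, some finite $p$-quotient
  \<open>\<pi> : \<Gamma> \<rightarrow> Q\<close> embeds every edge group and sends the vertex groups at the ends of a non-loop \<open>e\<close> to
  strictly larger subgroups than $G_e$. The key inequality is
  \[ \sum_e \frac{1}{|\pi G_e|} - \sum_v \frac{1}{|\pi G_v|} \le \mathrm{rk}(\Gamma) - 1. \]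
  It is obtained by counting the lifts of \<open>\<pi>\<close> to the wreath product of $\mathbb{Z}/p$ with \<open>Q\<close>, that is, the
  derivations from \<open>\<Gamma>\<close> to \<open>M = Map(Q, \<int>/p)\<close>. There are at most $|M|^{\mathrm{rk}(\Gamma)}$ of them, as a lift
  is determined on generators. On the other hand, by the universal property a lift arises from elements
  $m_v, \tau_e \in M$ (with $\tau_e = 0$ on the subtree), acting on $G_v$ by the inner derivation of $m_v$,
  as soon as one element $D_e$ of \<open>M\<close>, linear in these data, is fixed by $G_e$ for each \<open>e\<close>; moreover
  $m_v$ matters only modulo $M^{G_v}$, and $\log_p |M^H| = |Q|/|H|$ for subgroups \<open>H\<close> of \<open>Q\<close>.

  Finally, every vertex but a root is matched with the edge leading towards the root. Each edge, with the
  vertex matched to it if there is one, contributes at least $(1 - 1/p)/|G_e|$ to the left-hand side, and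
  one edge at the root makes up for the term of the root.
\<close>

section \<open>Finite connected graphs\<close>

text \<open>A breadth-first search from \<open>r\<close>: \<open>d v\<close> is the distance from
  \<open>r\<close> to \<open>v\<close> with orientations ignored, and \<open>par v\<close> is an arc
  from \<open>v\<close> to a vertex closer to \<open>r\<close>, such as the last arc of a shortest
  path.\<close>

lemma parent_arcs:
  fixes X :: "('v, 'e) pre_digraph"
  assumes "wf_digraph X" "Digraph_Component.connected X" and r: "r \<in> verts X"
  obtains par :: "'v \<Rightarrow> 'e" and up :: "'v \<Rightarrow> 'v" and d :: "'v \<Rightarrow> nat" where
    "\<And>v. v \<in> verts X - {r} \<Longrightarrow> par v \<in> arcs X \<and> up v \<in> verts X \<and> d (up v) < d v \<and>
       (tail X (par v) = v \<and> head X (par v) = up v \<or> tail X (par v) = up v \<and> head X (par v) = v)"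
    "inj_on par (verts X - {r})"
proof -
  interpret wf_digraph X by fact
  define R where "R = parcs (mk_symmetric X)"
  define d where "d v = (LEAST n. (r, v) \<in> R ^^ n)" for v
  have "\<exists>e u. e \<in> arcs X \<and> u \<in> verts X \<and> d u < d v \<and>
      (tail X e = v \<and> head X e = u \<or> tail X e = u \<and> head X e = v)" if v: "v \<in> verts X - {r}" for v
  proof -
    have "(r, v) \<in> R\<^sup>*"
      using assms v by (auto simp: connected_def strongly_connected_def reachable_def R_def
          intro: rtrancl_on_rtranclI)
    then obtain k where "(r, v) \<in> R ^^ k" using rtrancl_imp_relpow by blast
    then have dv: "(r, v) \<in> R ^^ d v" unfolding d_def by (rule LeastI)
    with v obtain m where m: "d v = Suc m" by (cases "d v") auto
    then obtain u where u: "(r, u) \<in> R ^^ m" "(u, v) \<in> R" using dv by auto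
    have "d u \<le> m" unfolding d_def using u(1) by (rule Least_le)
    then have "d u < d v" using m by simp
    moreover from u(2) obtain e where "e \<in> arcs X"
      "tail X e = v \<and> head X e = u \<or> tail X e = u \<and> head X e = v"
      by (auto simp: R_def parcs_mk_symmetric)
    moreover have "u \<in> verts X" using calculation(2,3) by auto
    ultimately show ?thesis by blast
  qed
  then obtain par up where pu: "\<And>v. v \<in> verts X - {r} \<Longrightarrow> par v \<in> arcs X \<and> up v \<in> verts X \<and> d (up v) < d v \<and>
       (tail X (par v) = v \<and> head X (par v) = up v \<or> tail X (par v) = up v \<and> head X (par v) = v)"
    by metis
  moreover have "inj_on par (verts X - {r})"
  proof (rule inj_onI, rule ccontr)
    fix v w assume vw: "v \<in> verts X - {r}" "w \<in> verts X - {r}" "par v = par w" "v \<noteq> w"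
    \<comment> \<open>An arc shared by two vertices would make each the parent of the other, so
      \<open>d\<close> would decrease in both directions.\<close>
    then have "up v = w" "up w = v" using pu[OF vw(1)] pu[OF vw(2)] by auto
    then show False using pu[OF vw(1)] pu[OF vw(2)] by simp
  qed
  ultimately show ?thesis by (rule that)
qed

text \<open>A traversal of an edge in either direction visits both of its ends, so a second use of
  the first edge of a walk would repeat the starting vertex.\<close>

lemma distinct_edges_two_way_apath:
  assumes "pre_digraph.cas (two_way X) u w v" "distinct (pre_digraph.awalk_verts (two_way X) u w)"
    "wf_digraph (two_way X)"
  shows "distinct (map fst w)"
  using assms(1,2)
proof (induction w arbitrary: u)
  case Nil
  then show ?case by simp
next
  interpret W: wf_digraph "two_way X" by fact
  case (Cons a w)
  let ?u = "head (two_way X) a"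
  have w: "W.cas ?u w v" "distinct (W.awalk_verts ?u w)"
    and a: "tail (two_way X) a \<notin> set (W.awalk_verts ?u w)"
    using Cons.prems by auto
  have "fst a \<notin> fst ` set w"
  proof
    assume "fst a \<in> fst ` set w"
    then obtain x b b' where a': "(x, b') \<in> set w" "a = (x, b)" by (cases a) auto
    then have "tail (two_way X) a \<in> {tail (two_way X) (x, b'), head (two_way X) (x, b')}"
      by (auto simp: two_way_def)
    with a'(1) a show False using W.set_awalk_verts_cas[OF w(1)] by auto
  qed
  with Cons.IH[OF w] show ?case by auto
qed

text \<open>The |V| - 1 parent arcs already join every vertex to the root. Any further arc can be
  removed without disconnecting the graph, and a path between its ends in what remains closes it up
  to a circuit.\<close>

lemma card_arcs_undirected_tree:
  assumes fin: "fin_digraph X" and tree: "undirected_tree X"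
  shows "card (arcs X) < card (verts X)"
proof (rule ccontr)
  assume neg: "\<not> ?thesis"
  interpret fin_digraph X by fact
  have conn: "Digraph_Component.connected X" and acyc: "\<nexists>w. circuit X w"
    using tree by (auto simp: undirected_tree_def)
  from conn obtain r where r: "r \<in> verts X" by (auto simp: connected_def strongly_connected_def)
  from parent_arcs[OF wf_digraph_axioms conn r] obtain par up d where
    pu: "\<And>v. v \<in> verts X - {r} \<Longrightarrow> par v \<in> arcs X \<and> up v \<in> verts X \<and> d (up v) < (d v :: nat) \<and>
       (tail X (par v) = v \<and> head X (par v) = up v \<or> tail X (par v) = up v \<and> head X (par v) = v)"
    and inj: "inj_on par (verts X - {r})" by metis
  have "card (par ` (verts X - {r})) < card (arcs X)"
    using neg r card_gt_0_iff[of "verts X"] by (auto simp: card_image[OF inj])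
  then have "par ` (verts X - {r}) \<noteq> arcs X" by auto
  \<comment> \<open>without \<open>e\<close> the graph stays connected via the parent arcs, so \<open>e\<close> lies on a circuit\<close>
  then obtain e where e: "e \<in> arcs X" "e \<notin> par ` (verts X - {r})" using pu by auto
  define X' where "X' = X\<lparr>arcs := arcs X - {e}\<rparr>"
  have X'_simps: "verts X' = verts X" "arcs X' = arcs X - {e}" "tail X' = tail X" "head X' = head X"
    by (simp_all add: X'_def)
  have wfW: "wf_digraph (two_way Y)" if "wf_digraph Y" for Y :: "('a, 'b) pre_digraph"
  proof -
    interpret Y: wf_digraph Y by fact
    show ?thesis by unfold_locales (auto simp: two_way_def split: if_splits)
  qed
  have "wf_digraph X'" by unfold_locales (auto simp: X'_simps)
  then interpret W: wf_digraph "two_way X'" by (rule wfW)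
  interpret WX: wf_digraph "two_way X" by (rule wfW[OF wf_digraph_axioms])
  let ?W = "two_way X'"
  have arcW: "(a, b) \<in> arcs ?W \<longleftrightarrow> a \<in> arcs X - {e}" for a b
    by (auto simp: two_way_def X'_simps)
  have vW: "verts ?W = verts X" by (simp add: two_way_def X'_simps)
  have step: "tail X a \<rightarrow>\<^bsub>?W\<^esub> head X a" "head X a \<rightarrow>\<^bsub>?W\<^esub> tail X a" if "a \<in> arcs X - {e}" for a
    using W.in_arcs_imp_in_arcs_ends[of "(a, True)"] W.in_arcs_imp_in_arcs_ends[of "(a, False)"] that
    unfolding arcW by (simp_all add: two_way_def X'_simps arc_to_ends_def)
  \<comment> \<open>Induction on the distance to the root; parent arcs differ from \<open>e\<close>,
    so they survive in \<open>X'\<close>.\<close>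
  have root: "v \<rightarrow>\<^sup>*\<^bsub>?W\<^esub> r \<and> r \<rightarrow>\<^sup>*\<^bsub>?W\<^esub> v" if "v \<in> verts X" for v
    using that
  proof (induction "d v" arbitrary: v rule: less_induct)
    case less
    show ?case
    proof (cases "v = r")
      case True
      then show ?thesis using r by (simp add: vW)
    next
      case False
      with less.prems have v: "v \<in> verts X - {r}" by auto
      have IH: "up v \<rightarrow>\<^sup>*\<^bsub>?W\<^esub> r \<and> r \<rightarrow>\<^sup>*\<^bsub>?W\<^esub> up v" using less.hyps pu[OF v] by blast
      have "par v \<in> arcs X - {e}" using pu[OF v] e(2) v by blast
      from step[OF this] pu[OF v] have "v \<rightarrow>\<^bsub>?W\<^esub> up v" "up v \<rightarrow>\<^bsub>?W\<^esub> v" by auto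
      with IH show ?thesis
        using W.adj_reachable_trans W.reachable_adj_trans by blast
    qed
  qed
  have "head X e \<rightarrow>\<^sup>*\<^bsub>?W\<^esub> tail X e"
    using W.reachable_trans[of "head X e" r "tail X e"] root e(1) by simp
  then obtain w where w: "W.apath (head X e) w (tail X e)"
    using W.reachable_apath by blast
  have "set w \<subseteq> arcs ?W" and casw: "W.cas (head X e) w (tail X e)"
    and dist: "distinct (W.awalk_verts (head X e) w)"
    using w by (auto simp: W.apath_def W.awalk_def)
  then have e_notin: "e \<notin> fst ` set w" and sub: "set w \<subseteq> arcs (two_way X)"
    by (auto simp: two_way_def X'_simps)
  have "distinct (map fst w)"
    using distinct_edges_two_way_apath[OF casw dist] W.wf_digraph_axioms by blast
  moreover have ends: "tail (two_way X) = tail ?W" "head (two_way X) = head ?W"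
    by (auto simp: two_way_def X'_simps fun_eq_iff)
  have "WX.cas u w v = W.cas u w v" for u v
    by (induction w arbitrary: u) (simp_all add: pre_digraph.cas.simps ends)
  then have "WX.cas (head X e) w (tail X e)" using casw by simp
  then have "WX.awalk (tail X e) ((e, True) # w) (tail X e)"
  proof -
    have "tail (two_way X) (e, True) = tail X e" "head (two_way X) (e, True) = head X e"
      "(e, True) \<in> arcs (two_way X)" "tail X e \<in> verts (two_way X)"
      using e(1) by (auto simp: two_way_def)
    then show ?thesis
      using sub \<open>WX.cas (head X e) w (tail X e)\<close> by (simp add: WX.awalk_def)
  qed
  ultimately have "circuit X ((e, True) # w)"
    using e_notin unfolding circuit_def by auto
  with acyc show False by blast
qed

lemma card_arcs_maximal_subtree:
  assumes "fin_digraph X" "maximal_subtree X T"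
  shows "card (arcs T) < card (verts X)" "arcs T \<subseteq> arcs X"
proof -
  interpret fin_digraph X by fact
  have T: "subgraph T X" "undirected_tree T"
    using assms(2) by (auto simp: maximal_subtree_def max_subgraph_def)
  then have sub: "verts T \<subseteq> verts X" "arcs T \<subseteq> arcs X" "wf_digraph T"
    by (auto simp: subgraph_def)
  interpret T: wf_digraph T by fact
  have "fin_digraph T"
    using sub finite_subset[of _ "verts X"] finite_subset[of _ "arcs X"]
    by unfold_locales auto
  then show "card (arcs T) < card (verts X)"
    using card_arcs_undirected_tree[OF _ T(2)] card_mono[OF finite_verts sub(1)] by linarith
  show "arcs T \<subseteq> arcs X" by fact
qed

text \<open>In the application \<open>a e\<close> and \<open>b v\<close> are the reciprocals of the
  orders of the images of edge and vertex groups in a finite quotient, and \<open>c\<close> is 1/K.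
  Each vertex other than the root is charged to its parent arc, \<open>w e\<close> being the charge
  on \<open>e\<close>. The root is charged to the arc \<open>e0\<close>, which is left out of the
  count: hence |E| - 1.\<close>

lemma sum_edge_vertex_bound:
  fixes a :: "'e \<Rightarrow> real" and b :: "'v \<Rightarrow> real"
  assumes fin: "fin_digraph X" and conn: "Digraph_Component.connected X" and ne: "arcs X \<noteq> {}"
    and p: "p \<ge> (2 :: real)" and a: "\<And>e. e \<in> arcs X \<Longrightarrow> a e \<ge> c" and c: "c \<ge> 0"
    and tl: "\<And>e. e \<in> arcs X \<Longrightarrow> b (tail X e) \<le> a e"
    and nl: "\<And>e. e \<in> arcs X \<Longrightarrow> tail X e \<noteq> head X e \<Longrightarrow> p * b (tail X e) \<le> a e \<and> p * b (head X e) \<le> a e"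
  shows "(p - 1) / p * c * (real (card (arcs X)) - 1) \<le> (\<Sum>e\<in>arcs X. a e) - (\<Sum>v\<in>verts X. b v)"
proof -
  interpret fin_digraph X by fact
  obtain e0 where e0: "e0 \<in> arcs X" using ne by blast
  \<comment> \<open>With the tail of \<open>e0\<close> as root, \<open>tl\<close> bounds
    \<open>b r\<close> even when \<open>e0\<close> is a loop.\<close>
  define r where "r = tail X e0"
  have r: "r \<in> verts X" using e0 by (simp add: r_def)
  from parent_arcs[OF wf_digraph_axioms conn r] obtain par up d where
    pu: "\<And>v. v \<in> verts X - {r} \<Longrightarrow> par v \<in> arcs X \<and> up v \<in> verts X \<and> d (up v) < (d v :: nat) \<and>
       (tail X (par v) = v \<and> head X (par v) = up v \<or> tail X (par v) = up v \<and> head X (par v) = v)"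
    and inj: "inj_on par (verts X - {r})" by metis
  let ?P = "par ` (verts X - {r})"
  define w where "w e = (if e \<in> ?P then b (the_inv_into (verts X - {r}) par e) else 0)" for e
  have wpar: "w (par v) = b v" if "v \<in> verts X - {r}" for v
    using that by (simp add: w_def the_inv_into_f_f[OF inj])
  have "(\<Sum>e\<in>arcs X. w e) = (\<Sum>e\<in>?P. w e)"
    using pu by (intro sum.mono_neutral_right) (auto simp: w_def)
  also have "\<dots> = (\<Sum>v\<in>verts X - {r}. b v)"
    using wpar by (simp add: sum.reindex[OF inj])
  finally have sumb: "(\<Sum>v\<in>verts X. b v) = b r + (\<Sum>e\<in>arcs X. w e)"
    using r by (simp add: sum.remove[of "verts X" r])
  have wle: "p * w e \<le> a e" "tail X e = head X e \<Longrightarrow> w e = 0" if "e \<in> arcs X" for e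
  proof -
    have "p * w e \<le> a e \<and> (tail X e = head X e \<longrightarrow> w e = 0)"
    proof (cases "e \<in> ?P")
      case True
      then obtain v where v: "v \<in> verts X - {r}" "e = par v" by blast
      \<comment> \<open>A parent arc joins vertices at different distances, so it is no loop, and
        \<open>nl\<close> covers whichever end \<open>v\<close> is.\<close>
      with pu[OF v(1)] have "tail X e \<noteq> head X e" by auto
      then show ?thesis using nl[OF that] pu[OF v(1)] v by (auto simp: wpar)
    next
      case False
      then show ?thesis using a[OF that] c by (simp add: w_def)
    qed
    then show "p * w e \<le> a e" "tail X e = head X e \<Longrightarrow> w e = 0" by auto
  qed
  have lower: "(p - 1) / p * c \<le> a e - w e" if "e \<in> arcs X" for e
  proof -
    have "(p - 1) / p * c \<le> (p - 1) / p * a e"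
      using a[OF that] p by (intro mult_left_mono) auto
    also have "\<dots> \<le> a e - w e" using wle(1)[OF that] p by (simp add: field_simps)
    finally show ?thesis .
  qed
  have root: "b r \<le> a e0 - w e0"
  proof (cases "tail X e0 = head X e0")
    case True
    then show ?thesis using wle(2)[OF e0] tl[OF e0] by (simp add: r_def)
  next
    case False
    \<comment> \<open>If \<open>e0\<close> is not a loop, it may carry the root and also the vertex
      whose parent arc it is. Each costs at most \<open>a e0 / p\<close>, and p >= 2 leaves room for
      both.\<close>
    have "p * b r \<le> a e0" "p * w e0 \<le> a e0" using nl[OF e0 False] wle(1)[OF e0] by (auto simp: r_def)
    then have "p * (b r + w e0) \<le> 2 * a e0" by (simp add: algebra_simps)
    also have "\<dots> \<le> p * a e0" using p a[OF e0] c by (intro mult_right_mono) auto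
    finally show ?thesis using p by simp
  qed
  have "(p - 1) / p * c * (real (card (arcs X)) - 1) = (\<Sum>e\<in>arcs X - {e0}. (p - 1) / p * c)"
    using e0 by (simp add: card_gt_0_iff of_nat_diff Suc_leI ne)
  also have "\<dots> \<le> (\<Sum>e\<in>arcs X - {e0}. a e - w e)"
    using lower by (intro sum_mono) auto
  also have "\<dots> = (\<Sum>e\<in>arcs X. a e - w e) - (a e0 - w e0)"
    using e0 by (simp add: sum.remove[of "arcs X" e0])
  also have "\<dots> \<le> (\<Sum>e\<in>arcs X. a e) - (\<Sum>v\<in>verts X. b v)"
    using root sumb by (simp add: sum_subtractf)
  finally show ?thesis .
qed



section \<open>Finite $p$-groups\<close>

lemma pro_p_group_discrete:
  assumes p: "prime p" and G: "Group.group G" and card: "order G = p ^ n"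
    and top: "gtop G = discrete_topology (carrier G)"
  shows "pro_p_group p G"
proof -
  interpret Group.group G by fact
  have fin: "finite (carrier G)"
    using card p prime_gt_0_nat[OF p] by (metis card.infinite order_def power_eq_0_iff less_irrefl)
  show ?thesis
    unfolding pro_p_group_def topological_group_def
  proof (intro conjI allI impI)
    show "continuous_map (prod_topology (gtop G) (gtop G)) (gtop G) (\<lambda>(x, y). x \<otimes>\<^bsub>G\<^esub> y)"
      by (auto simp: top prod_topology_discrete_topology[symmetric])
    show "\<exists>N. N \<lhd> G \<and> openin (gtop G) N \<and> N \<subseteq> U" if "openin (gtop G) U \<and> \<one>\<^bsub>G\<^esub> \<in> U" for U
      using that one_is_normal by (intro exI[of _ "{\<one>\<^bsub>G\<^esub>}"]) (auto simp: top)
    show "\<exists>n. order (G Mod N) = p ^ n" if "N \<lhd> G \<and> openin (gtop G) N" for N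
    proof -
      have "subgroup N G" using that by (simp add: normal_imp_subgroup)
      from lagrange[OF this] have "card (rcosets\<^bsub>G\<^esub> N) dvd p ^ n"
        using card by (metis dvd_triv_left)
      then show ?thesis using p by (auto simp: order_def FactGroup_def divides_primepow_nat)
    qed
    show "continuous_map (gtop G) (gtop G) (\<lambda>x. inv\<^bsub>G\<^esub> x)"
      by (auto simp: top)
  qed (use G fin in \<open>auto simp: top compact_space_discrete_topology\<close>)
qed

text \<open>Compactness makes a discrete group finite, and its trivial subgroup is open, so the
  group is one of its own finite quotients.\<close>

lemma order_pro_p_group_discrete:
  assumes "prime p" "pro_p_group p G" "gtop G = discrete_topology (carrier G)"
  shows "finite (carrier G)" "\<exists>n. order G = p ^ n"
proof -
  interpret Group.group G using pro_p_groupD(1)[OF assms(2)] .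
  show fin: "finite (carrier G)"
    using pro_p_groupD(3)[OF assms(2)] by (simp add: assms(3) compact_space_discrete_topology)
  have "\<exists>n. order (G Mod {\<one>\<^bsub>G\<^esub>}) = p ^ n"
    using assms(2) one_is_normal unfolding pro_p_group_def by (simp add: assms(3))
  moreover have "order (G Mod {\<one>\<^bsub>G\<^esub>}) = order G"
    using lagrange[OF triv_subgroup] by (simp add: order_def FactGroup_def)
  ultimately show "\<exists>n. order G = p ^ n" by simp
qed

text \<open>The group $\mathbb{Z}/p$ is modelled by the residues \<open>{0..<p}\<close>, and elements of the base group are
  extensional functions on \<open>Q\<close>, on which \<open>Q\<close> acts from the right by \<open>(f \<cdot> b) x = f (b x)\<close>; so the fixed
  points of a subgroup \<open>H\<close> are the functions constant on the right cosets \<open>H x\<close>.\<close>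

definition wreath :: "nat \<Rightarrow> ('q, 'z) monoid_scheme \<Rightarrow> (('q \<Rightarrow> int) \<times> 'q) top_group" where
  "wreath p Q =
     \<lparr>carrier = (carrier Q \<rightarrow>\<^sub>E {0..<int p}) \<times> carrier Q,
      monoid.mult = (\<lambda>(f, a) (g, b). (\<lambda>x\<in>carrier Q. (f (b \<otimes>\<^bsub>Q\<^esub> x) + g x) mod int p, a \<otimes>\<^bsub>Q\<^esub> b)),
      one = (\<lambda>x\<in>carrier Q. 0, \<one>\<^bsub>Q\<^esub>),
      gtop = discrete_topology ((carrier Q \<rightarrow>\<^sub>E {0..<int p}) \<times> carrier Q)\<rparr>"

text \<open>For \<open>m\<close> in the base group this is the conjugate of (0, a) by (m, 1), so its
  first component is the inner derivation of \<open>m\<close>. Each \<open>m\<close> thus gives a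
  lift of the identity of \<open>Q\<close> to the wreath product.\<close>

definition coboundary :: "nat \<Rightarrow> ('q, 'z) monoid_scheme \<Rightarrow> ('q \<Rightarrow> int) \<Rightarrow> 'q \<Rightarrow> ('q \<Rightarrow> int) \<times> 'q" where
  "coboundary p Q m a = (\<lambda>x\<in>carrier Q. (m (a \<otimes>\<^bsub>Q\<^esub> x) - m x) mod int p, a)"

lemma wreath_simps:
  "carrier (wreath p Q) = (carrier Q \<rightarrow>\<^sub>E {0..<int p}) \<times> carrier Q"
  "(f, a) \<otimes>\<^bsub>wreath p Q\<^esub> (g, b) = (\<lambda>x\<in>carrier Q. (f (b \<otimes>\<^bsub>Q\<^esub> x) + g x) mod int p, a \<otimes>\<^bsub>Q\<^esub> b)"
  "\<one>\<^bsub>wreath p Q\<^esub> = (\<lambda>x\<in>carrier Q. 0, \<one>\<^bsub>Q\<^esub>)"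
  "gtop (wreath p Q) = discrete_topology (carrier (wreath p Q))"
  by (simp_all add: wreath_def)

lemma group_wreath:
  assumes "Group.group Q" "p > 0"
  shows "Group.group (wreath p Q)"
proof -
  interpret Group.group Q by fact
  show ?thesis
  proof (rule groupI)
    show "\<one>\<^bsub>wreath p Q\<^esub> \<in> carrier (wreath p Q)"
      using \<open>p > 0\<close> by (auto simp: wreath_simps)
    fix x assume x: "x \<in> carrier (wreath p Q)"
    obtain f a where fa: "x = (f, a)" by (cases x)
    then have f: "f \<in> carrier Q \<rightarrow>\<^sub>E {0..<int p}" and a: "a \<in> carrier Q" using x by (auto simp: wreath_simps)
    have fmod: "f y mod int p = f y" if "y \<in> carrier Q" for y
      using PiE_mem[OF f that] by simp
    show "\<one>\<^bsub>wreath p Q\<^esub> \<otimes>\<^bsub>wreath p Q\<^esub> x = x"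
      using a PiE_ext[of "\<lambda>x\<in>carrier Q. f x mod int p" "carrier Q" _ f] f
      by (auto simp: fa wreath_simps fmod fun_eq_iff PiE_def extensional_def)
    show "\<exists>y\<in>carrier (wreath p Q). y \<otimes>\<^bsub>wreath p Q\<^esub> x = \<one>\<^bsub>wreath p Q\<^esub>"
    proof
      let ?y = "(\<lambda>x\<in>carrier Q. (- f (inv\<^bsub>Q\<^esub> a \<otimes>\<^bsub>Q\<^esub> x)) mod int p, inv\<^bsub>Q\<^esub> a)"
      show "?y \<in> carrier (wreath p Q)" using a \<open>p > 0\<close> by (auto simp: wreath_simps)
      show "?y \<otimes>\<^bsub>wreath p Q\<^esub> x = \<one>\<^bsub>wreath p Q\<^esub>"
        using a by (auto simp: fa wreath_simps fun_eq_iff m_assoc[symmetric] mod_simps)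
    qed
    fix y assume y: "y \<in> carrier (wreath p Q)"
    show "x \<otimes>\<^bsub>wreath p Q\<^esub> y \<in> carrier (wreath p Q)"
      using x y \<open>p > 0\<close> by (auto simp: wreath_simps fa)
    fix z assume z: "z \<in> carrier (wreath p Q)"
    show "(x \<otimes>\<^bsub>wreath p Q\<^esub> y) \<otimes>\<^bsub>wreath p Q\<^esub> z = x \<otimes>\<^bsub>wreath p Q\<^esub> (y \<otimes>\<^bsub>wreath p Q\<^esub> z)"
      using x y z by (auto simp: wreath_simps fun_eq_iff m_assoc mod_simps add.assoc)
  qed
qed

lemma pro_p_group_wreath:
  assumes p: "prime p" and Q: "Group.group Q" and card: "order Q = p ^ n"
  shows "pro_p_group p (wreath p Q)"
proof (rule pro_p_group_discrete[OF p])
  show "Group.group (wreath p Q)" using Q p by (intro group_wreath) (auto simp: prime_gt_0_nat)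
  have "finite (carrier Q)"
    using card p prime_gt_0_nat[OF p] by (metis card.infinite order_def power_eq_0_iff less_irrefl)
  then have "order (wreath p Q) = p ^ order Q * order Q"
    by (simp add: order_def wreath_simps card_PiE card_cartesian_product)
  also have "\<dots> = p ^ (order Q + n)" by (simp add: card power_add)
  finally show "order (wreath p Q) = p ^ (order Q + n)" .
qed (rule wreath_simps)

lemma coboundary_hom:
  assumes "Group.group Q" "p > 0"
  shows "coboundary p Q m \<in> hom Q (wreath p Q)"
proof -
  interpret Group.group Q by fact
  show ?thesis using \<open>p > 0\<close>
    by (auto simp: hom_def coboundary_def wreath_simps fun_eq_iff m_assoc mod_simps)
qed

lemma snd_wreath_hom: "snd \<in> hom (wreath p Q) Q"
  by (auto simp: hom_def wreath_simps)

text \<open>The relation of a specialisation at an edge, with the inverse multiplied away: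
  \<open>a\<close> and \<open>b\<close> come from one edge group element at the tail and at the
  head, and \<open>(\<tau>, q)\<close> from the stable letter. Since a q x = q b x, comparing base
  components at \<open>x\<close> leaves exactly the invariance of m(q x) - \<tau>(x) - m'(x) under
  replacing \<open>x\<close> by \<open>b x\<close>.\<close>

lemma coboundary_conj:
  assumes "Group.group Q" "q \<in> carrier Q" "b \<in> carrier Q" "a \<in> carrier Q"
    and ab: "a \<otimes>\<^bsub>Q\<^esub> q = q \<otimes>\<^bsub>Q\<^esub> b"
    and D: "\<And>x. x \<in> carrier Q \<Longrightarrow>
      (m (q \<otimes>\<^bsub>Q\<^esub> (b \<otimes>\<^bsub>Q\<^esub> x)) - \<tau> (b \<otimes>\<^bsub>Q\<^esub> x) - m' (b \<otimes>\<^bsub>Q\<^esub> x)) mod int p =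
      (m (q \<otimes>\<^bsub>Q\<^esub> x) - \<tau> x - m' x) mod int p"
  shows "coboundary p Q m a \<otimes>\<^bsub>wreath p Q\<^esub> (\<tau>, q) = (\<tau>, q) \<otimes>\<^bsub>wreath p Q\<^esub> coboundary p Q m' b"
proof -
  interpret Group.group Q by fact
  have "((m (a \<otimes>\<^bsub>Q\<^esub> (q \<otimes>\<^bsub>Q\<^esub> x)) - m (q \<otimes>\<^bsub>Q\<^esub> x)) mod int p + \<tau> x) mod int p =
      (\<tau> (b \<otimes>\<^bsub>Q\<^esub> x) + (m' (b \<otimes>\<^bsub>Q\<^esub> x) - m' x) mod int p) mod int p"
    if x: "x \<in> carrier Q" for x
  proof -
    have "a \<otimes>\<^bsub>Q\<^esub> (q \<otimes>\<^bsub>Q\<^esub> x) = q \<otimes>\<^bsub>Q\<^esub> (b \<otimes>\<^bsub>Q\<^esub> x)"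
      using assms(2-4) ab x by (simp flip: m_assoc)
    moreover have "int p dvd (m (q \<otimes>\<^bsub>Q\<^esub> (b \<otimes>\<^bsub>Q\<^esub> x)) - \<tau> (b \<otimes>\<^bsub>Q\<^esub> x) - m' (b \<otimes>\<^bsub>Q\<^esub> x)) -
        (m (q \<otimes>\<^bsub>Q\<^esub> x) - \<tau> x - m' x)"
      using D[OF x] by (simp add: mod_eq_dvd_iff)
    ultimately show ?thesis
      by (simp add: mod_simps) (simp add: mod_eq_dvd_iff algebra_simps)
  qed
  then show ?thesis using assms(2-4) ab
    by (auto simp: coboundary_def wreath_simps fun_eq_iff)
qed

section \<open>Coset representatives\<close>

text \<open>The choice is made from the coset as a set, so all its elements share one
  representative. Representatives index the free values of an \<open>H\<close>-invariant function;
  the other elements index the conditions for invariance.\<close>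

definition coset_rep :: "('q, 'z) monoid_scheme \<Rightarrow> 'q set \<Rightarrow> 'q \<Rightarrow> 'q" where
  "coset_rep Q H x = (SOME y. y \<in> H #>\<^bsub>Q\<^esub> x)"

context Group.group
begin

lemma coset_rep:
  assumes "subgroup H G" "x \<in> carrier G"
  shows "\<exists>h\<in>H. coset_rep G H x = h \<otimes> x" "coset_rep G H x \<in> carrier G"
proof -
  have "coset_rep G H x \<in> H #> x"
    unfolding coset_rep_def using rcos_self[OF assms(2,1)] by (rule someI)
  then show "\<exists>h\<in>H. coset_rep G H x = h \<otimes> x" by (auto simp: r_coset_def)
  then show "coset_rep G H x \<in> carrier G"
    using assms subgroup.mem_carrier by fastforce
qed

lemma coset_rep_mult:
  assumes "subgroup H G" "x \<in> carrier G" "h \<in> H"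
  shows "coset_rep G H (h \<otimes> x) = coset_rep G H x"
proof -
  have "h \<otimes> x \<in> H #> x" using assms(3) by (auto simp: r_coset_def)
  from repr_independence[OF this assms(2,1)] show ?thesis by (simp add: coset_rep_def)
qed

text \<open>Distinct cosets are disjoint and so have distinct representatives; the count is then
  Lagrange's theorem.\<close>

lemma card_coset_reps:
  assumes "subgroup H G" "finite (carrier G)"
  shows "card (coset_rep G H ` carrier G) * card H = order G"
proof -
  have "coset_rep G H ` carrier G = (\<lambda>C. SOME y. y \<in> C) ` (rcosets H)"
    by (auto simp: coset_rep_def RCOSETS_def)
  moreover have "inj_on (\<lambda>C. SOME y. y \<in> C) (rcosets H)"
  proof (rule inj_onI)
    have some: "(SOME y. y \<in> C) \<in> C" if "C \<in> rcosets H" for C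
    proof -
      obtain x where "x \<in> carrier G" "C = H #> x" using \<open>C \<in> rcosets H\<close> unfolding RCOSETS_def by blast
      then have "x \<in> C" using rcos_self[OF _ assms(1)] by simp
      then show ?thesis by (rule someI)
    qed
    fix C D assume CD: "C \<in> rcosets H" "D \<in> rcosets H" "(SOME y. y \<in> C) = (SOME y. y \<in> D)"
    then have "(SOME y. y \<in> C) \<in> C" "(SOME y. y \<in> C) \<in> D"
      using some by metis+
    then show "C = D" using rcos_disjoint[OF assms(1)] CD by (auto simp: pairwise_def disjnt_iff)
  qed
  ultimately show ?thesis using lagrange[OF assms(1)] by (simp add: card_image)
qed

end

section \<open>Counting solutions of linear congruences\<close>

text \<open>A counting form of rank-nullity: subtracting a fixed element of a nonempty fibre of
  \<open>h\<close> embeds the fibre in the kernel, and there are at most p^|J| fibres. Compatibility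
  of \<open>L\<close> with differences modulo p suffices for this.\<close>

lemma card_kernel_congruences:
  fixes L :: "('i \<Rightarrow> int) \<Rightarrow> 'j \<Rightarrow> int"
  assumes "finite I" "finite J" and p: "p > 0"
    and lin: "\<And>a b j. a \<in> I \<rightarrow>\<^sub>E {0..<int p} \<Longrightarrow> b \<in> I \<rightarrow>\<^sub>E {0..<int p} \<Longrightarrow> j \<in> J \<Longrightarrow>
      L (\<lambda>i\<in>I. (a i - b i) mod int p) j mod int p = (L a j - L b j) mod int p"
  shows "p ^ card I \<le> p ^ card J *
    card {a \<in> I \<rightarrow>\<^sub>E {0..<int p}. \<forall>j\<in>J. L a j mod int p = 0}" (is "_ \<le> _ * card ?K")
proof -
  let ?A = "I \<rightarrow>\<^sub>E {0..<int p}" and ?B = "J \<rightarrow>\<^sub>E {0..<int p}"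
  define h where "h a = (\<lambda>j\<in>J. L a j mod int p)" for a
  have finA: "finite ?A" and finB: "finite ?B" using assms by (auto intro: finite_PiE)
  have hB: "h a \<in> ?B" for a using p by (auto simp: h_def)
  have fibre: "card {a \<in> ?A. h a = b} \<le> card ?K" for b
  proof (cases "\<exists>a0\<in>?A. h a0 = b")
    case True
    then obtain a0 where a0: "a0 \<in> ?A" "h a0 = b" by blast
    let ?f = "\<lambda>a. \<lambda>i\<in>I. (a i - a0 i) mod int p"
    show ?thesis
    proof (rule card_inj_on_le)
      show "inj_on ?f {a \<in> ?A. h a = b}"
      proof (rule inj_onI)
        fix a a' assume a: "a \<in> {a \<in> ?A. h a = b}" and a': "a' \<in> {a \<in> ?A. h a = b}"
          and eq: "?f a = ?f a'"
        show "a = a'"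
        proof (rule PiE_ext)
          show "a \<in> ?A" "a' \<in> ?A" using a a' by auto
          fix i assume i: "i \<in> I"
          have "(a i - a0 i) mod int p = (a' i - a0 i) mod int p"
            using fun_cong[OF eq, of i] i by simp
          then have "a i mod int p = a' i mod int p" by (simp add: mod_eq_dvd_iff)
          moreover have "a i \<in> {0..<int p}" "a' i \<in> {0..<int p}" using a a' i by auto
          ultimately show "a i = a' i" by simp
        qed
      qed
      show "?f ` {a \<in> ?A. h a = b} \<subseteq> ?K"
      proof
        fix c assume "c \<in> ?f ` {a \<in> ?A. h a = b}"
        then obtain a where a: "a \<in> ?A" "h a = b" "c = ?f a" by blast
        have "L c j mod int p = 0" if j: "j \<in> J" for j
        proof -
          have "L a j mod int p = L a0 j mod int p"
            using fun_cong[OF trans[OF a(2) a0(2)[symmetric]], of j] j by (simp add: h_def)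
          then show ?thesis using lin[OF a(1) a0(1) j] a(3) by (simp add: mod_eq_dvd_iff)
        qed
        then show "c \<in> ?K" using a(3) p by auto
      qed
      show "finite ?K" using finA by simp
    qed
  next
    case False
    then have "{a \<in> ?A. h a = b} = {}" by blast
    then show ?thesis by (simp only: card.empty le0)
  qed
  have "?A = (\<Union>b\<in>?B. {a \<in> ?A. h a = b})" using hB by blast
  then have "card ?A = card (\<Union>b\<in>?B. {a \<in> ?A. h a = b})" by simp
  also have "\<dots> \<le> (\<Sum>b\<in>?B. card {a \<in> ?A. h a = b})" by (rule card_UN_le[OF finB])
  also have "\<dots> \<le> card ?B * card ?K" using sum_bounded_above[of ?B, OF fibre] by simp
  finally show ?thesis using assms by (simp add: card_PiE)
qed



section \<open>Continuous homomorphisms of pro-$p$ groups\<close>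

lemma cont_hom_from_discrete:
  assumes "f \<in> hom A B" "gtop A = discrete_topology (carrier A)" "topspace (gtop B) = carrier B"
  shows "f \<in> cont_hom A B"
  using assms by (auto simp: cont_hom_def hom_def)

text \<open>The equaliser is closed because \<open>B\<close> is Hausdorff, and it contains the dense
  abstract subgroup generated by \<open>S\<close>.\<close>

lemma cont_hom_eq_on_generators:
  assumes A: "pro_p_group p A" and B: "pro_p_group p B"
    and f: "f \<in> cont_hom A B" and g: "g \<in> cont_hom A B"
    and S: "top_generates A S" and eq: "\<And>s. s \<in> S \<Longrightarrow> f s = g s" and x: "x \<in> carrier A"
  shows "f x = g x"
proof -
  note grp = pro_p_groupD(1)[OF A] pro_p_groupD(1)[OF B]
  interpret A: Group.group A by (rule grp)
  let ?E = "{x \<in> topspace (gtop A). f x = g x}"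
  have SA: "S \<subseteq> carrier A" using S by (simp add: top_generates_def)
  have "generate A S \<subseteq> ?E"
  proof
    fix y assume "y \<in> generate A S"
    then show "y \<in> ?E"
    proof (induction rule: generate.induct)
      case one
      then show ?case using cont_hom_group(1)[OF f grp] cont_hom_group(1)[OF g grp]
        by (simp add: pro_p_groupD(2)[OF A])
    next
      case (incl h)
      then show ?case using eq SA by (auto simp: pro_p_groupD(2)[OF A])
    next
      case (inv h)
      then show ?case using eq SA cont_hom_group(2)[OF f grp] cont_hom_group(2)[OF g grp]
        by (auto simp: pro_p_groupD(2)[OF A])
    next
      case (eng h k)
      then show ?case using cont_homD(2)[OF f] cont_homD(2)[OF g]
        by (auto simp: pro_p_groupD(2)[OF A])
    qed
  qed
  then have "Abstract_Topology.closure_of (gtop A) (generate A S) \<subseteq> ?E"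
    by (rule closure_of_minimal)
      (intro closedin_continuous_maps_eq[OF pro_p_groupD(4)[OF B]] cont_homD(3)[OF f] cont_homD(3)[OF g])
  then show ?thesis using S x by (auto simp: top_generates_def)
qed

lemma cont_hom_img_subgroup:
  assumes "f \<in> cont_hom A B" "Group.group A" "Group.group B"
  shows "subgroup (f ` carrier A) B"
proof -
  interpret group_hom A B f
    using assms by (simp add: group_hom_def group_hom_axioms_def cont_hom_def)
  show ?thesis by (rule img_is_subgroup)
qed

text \<open>An isomorphism that is a homeomorphism commutes with abstract generation and with
  closure. This moves a generating set of \<open>G\<close> to the fundamental group without changing
  its size.\<close>

lemma top_generates_top_iso_preimage:
  assumes f: "f \<in> top_iso A B" and A: "pro_p_group p A" and B: "pro_p_group p B"
    and S: "top_generates B S"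
  shows "\<exists>S'. top_generates A S' \<and> bij_betw f S' S"
proof -
  note grp = pro_p_groupD(1)[OF A] pro_p_groupD(1)[OF B]
  interpret group_hom A B f
    using f grp by (simp add: group_hom_def group_hom_axioms_def top_iso_def iso_def)
  have hm: "homeomorphic_map (gtop A) (gtop B) f" and bij: "bij_betw f (carrier A) (carrier B)"
    using f by (auto simp: top_iso_def iso_def)
  have SB: "S \<subseteq> carrier B" and cl: "Abstract_Topology.closure_of (gtop B) (generate B S) = carrier B"
    using S by (auto simp: top_generates_def)
  let ?S = "{x \<in> carrier A. f x \<in> S}"
  have img: "f ` ?S = S"
  proof
    show "S \<subseteq> f ` ?S"
    proof
      fix y assume "y \<in> S"
      moreover from this obtain x where "x \<in> carrier A" "y = f x"
        using SB bij_betw_imp_surj_on[OF bij] by blast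
      ultimately show "y \<in> f ` ?S" by blast
    qed
  qed blast
  have "f ` (Abstract_Topology.closure_of (gtop A) (generate A ?S)) = Abstract_Topology.closure_of (gtop B) (f ` generate A ?S)"
    using G.generate_incl[of ?S]
    by (subst homeomorphic_map_closure_of[OF hm]) (auto simp: pro_p_groupD(2)[OF A])
  also have "f ` generate A ?S = generate B S"
    using generate_img[of ?S] img by simp
  finally have "f ` (Abstract_Topology.closure_of (gtop A) (generate A ?S)) = f ` carrier A"
    using cl bij_betw_imp_surj_on[OF bij] by simp
  moreover have "Abstract_Topology.closure_of (gtop A) (generate A ?S) \<subseteq> carrier A"
    using closure_of_subset_topspace[of "gtop A"] by (simp add: pro_p_groupD(2)[OF A])
  ultimately have "Abstract_Topology.closure_of (gtop A) (generate A ?S) = carrier A"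
    using bij_betw_imp_inj_on[OF bij] by (metis inj_on_image_eq_iff subset_refl)
  then have "top_generates A ?S" by (auto simp: top_generates_def)
  moreover have "bij_betw f ?S S"
    using img bij_betw_imp_inj_on[OF bij] by (auto simp: bij_betw_def intro: inj_on_subset)
  ultimately show ?thesis by blast
qed

lemma rk_attained:
  assumes "top_finitely_generated G"
  shows "\<exists>S. finite S \<and> card S = rk G \<and> top_generates G S"
  using assms LeastI_ex[of "\<lambda>n. \<exists>S. finite S \<and> card S = n \<and> top_generates G S"]
  unfolding rk_def top_finitely_generated_def by blast

text \<open>The trivial subgroup is closed in a Hausdorff group, so the empty set topologically
  generates nothing more.\<close>

lemma rk_pos:
  assumes G: "pro_p_group p G" "top_finitely_generated G" and nt: "carrier G \<noteq> {\<one>\<^bsub>G\<^esub>}"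
  shows "rk G > 0"
proof (rule ccontr)
  interpret Group.group G using pro_p_groupD(1)[OF G(1)] .
  assume "\<not> rk G > 0"
  then have "top_generates G {}" using rk_attained[OF G(2)] by auto
  then have "Abstract_Topology.closure_of (gtop G) {\<one>\<^bsub>G\<^esub>} = carrier G" by (simp add: top_generates_def generate_empty)
  moreover have "closedin (gtop G) {\<one>\<^bsub>G\<^esub>}"
    using pro_p_groupD(2,4)[OF G(1)] by (simp add: Hausdorff_imp_t1_space closedin_t1_singleton)
  ultimately show False using nt by (simp add: closure_of_closedin)
qed

text \<open>Finite sets are closed, so the complement of \<open>F\<close> is an open neighbourhood
  of the identity.\<close>

lemma open_normal_avoiding_finite:
  assumes G: "pro_p_group p G" and F: "finite F" "F \<subseteq> carrier G" "\<one>\<^bsub>G\<^esub> \<notin> F"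
  shows "\<exists>N. N \<lhd> G \<and> openin (gtop G) N \<and> N \<inter> F = {}"
proof -
  interpret Group.group G using pro_p_groupD(1)[OF G] .
  have "closedin (gtop G) F"
    using pro_p_groupD(2,4)[OF G] F
    by (simp add: closedin_Hausdorff_finite)
  then have "openin (gtop G) (carrier G - F)"
    using openin_diff[OF openin_topspace, of "gtop G" F] by (simp add: pro_p_groupD(2)[OF G])
  moreover have "\<one>\<^bsub>G\<^esub> \<in> carrier G - F" using F by simp
  ultimately show ?thesis using G unfolding pro_p_group_def by (meson Diff_disjoint Diff_iff disjoint_iff subsetD)
qed



section \<open>The Euler characteristic of a finite quotient\<close>

text \<open>Up to sign, the left-hand side is the rational Euler characteristic of the graph of
  finite groups formed by the images in \<open>Q\<close>.\<close>

lemma euler_characteristic_bound: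
  fixes Q :: "'q top_group" and \<G> :: "('v, 'e, 'a, 'b) graph_of_groups"
  assumes p: "prime p" and \<G>: "graph_of_pro_p_groups p \<G>" and T: "maximal_subtree (base \<G>) T"
    and \<Gamma>: "pro_p_fundamental_group p \<G> T \<Gamma> \<nu>V \<nu>E t"
    and Q: "pro_p_group p Q" "gtop Q = discrete_topology (carrier Q)"
    and \<pi>: "\<pi> \<in> cont_hom \<Gamma> Q"
    and S: "finite S" "top_generates \<Gamma> S"
  shows "(\<Sum>e\<in>arcs (base \<G>). 1 / real (card (\<pi> ` \<nu>E e ` carrier (egroup \<G> e)))) -
      (\<Sum>v\<in>verts (base \<G>). 1 / real (card (\<pi> ` \<nu>V v ` carrier (vgroup \<G> v)))) \<le> real (card S) - 1"
proof -

  \<comment> \<open>Notation and structure maps\<close>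
  define X where "X = base \<G>"
  define V where "V = verts X"
  define E where "E = arcs X"
  define P where "P = wreath p Q"
  have p0: "p > 0" "p > 1" using p prime_gt_0_nat prime_gt_1_nat by auto
  have fin: "fin_digraph X" using \<G> by (simp add: graph_of_pro_p_groups_def X_def)
  interpret X: fin_digraph X by fact
  have finV: "finite V" and finE: "finite E" by (simp_all add: V_def E_def)
  have ET: "card (arcs T) < card V" "arcs T \<subseteq> E"
    using card_arcs_maximal_subtree[OF fin] T by (simp_all add: X_def V_def E_def)
  have sp: "specialisation p \<G> T \<Gamma> \<nu>V \<nu>E t" using \<Gamma> by (simp add: pro_p_fundamental_group_def)
  have pp\<Gamma>: "pro_p_group p \<Gamma>" using sp by (simp add: specialisation_def)
  interpret \<Gamma>: Group.group \<Gamma> using pro_p_groupD(1)[OF pp\<Gamma>] .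
  interpret Q: Group.group Q using pro_p_groupD(1)[OF Q(1)] .
  note finQ = order_pro_p_group_discrete(1)[OF p Q]
  obtain n where n: "order Q = p ^ n" using order_pro_p_group_discrete(2)[OF p Q] by blast
  have ppP: "pro_p_group p P" unfolding P_def by (rule pro_p_group_wreath[OF p Q.group_axioms n])
  interpret P: Group.group P using pro_p_groupD(1)[OF ppP] .
  have \<nu>V: "\<nu>V v \<in> cont_hom (vgroup \<G> v) \<Gamma>" if "v \<in> V" for v
    using sp that by (simp add: specialisation_def V_def X_def)
  have vE: "tail X e \<in> V" "head X e \<in> V" if "e \<in> E" for e
    using that by (simp_all add: V_def E_def)
  have bd: "bd0 \<G> e \<in> cont_hom (egroup \<G> e) (vgroup \<G> (tail X e))"
    "bd1 \<G> e \<in> cont_hom (egroup \<G> e) (vgroup \<G> (head X e))"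
    "pro_p_group p (egroup \<G> e)" if "e \<in> E" for e
    using \<G> that by (simp_all add: graph_of_pro_p_groups_def X_def E_def)
  have ppV: "pro_p_group p (vgroup \<G> v)" if "v \<in> V" for v
    using \<G> that by (simp add: graph_of_pro_p_groups_def X_def V_def)
  have tc: "t e \<in> carrier \<Gamma>" if "e \<in> E" for e
    using sp that by (simp add: specialisation_def E_def X_def)
  have tT: "t e = \<one>\<^bsub>\<Gamma>\<^esub>" if "e \<in> arcs T" for e using sp that by (simp add: specialisation_def)
  have rel: "\<nu>V (tail X e) (bd0 \<G> e g) = \<nu>E e g"
    "\<nu>E e g = t e \<otimes>\<^bsub>\<Gamma>\<^esub> \<nu>V (head X e) (bd1 \<G> e g) \<otimes>\<^bsub>\<Gamma>\<^esub> inv\<^bsub>\<Gamma>\<^esub> (t e)"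
    if "e \<in> E" "g \<in> carrier (egroup \<G> e)" for e g
    using sp that by (auto simp: specialisation_def E_def X_def)

  \<comment> \<open>Images of the vertex and edge groups in \<open>Q\<close>\<close>
  define \<alpha> where "\<alpha> = (\<lambda>v g. \<pi> (\<nu>V v g))"
  define \<beta> where "\<beta> = (\<lambda>e g. \<alpha> (head X e) (bd1 \<G> e g))"
  define q where "q = (\<lambda>e. \<pi> (t e))"
  have \<alpha>: "\<alpha> v \<in> cont_hom (vgroup \<G> v) Q" if "v \<in> V" for v
    unfolding \<alpha>_def using cont_hom_compose[OF \<nu>V[OF that] \<pi>] .
  have \<beta>: "\<beta> e \<in> cont_hom (egroup \<G> e) Q" if "e \<in> E" for e
    unfolding \<beta>_def using cont_hom_compose[OF bd(2)[OF that] \<alpha>[OF vE(2)[OF that]]] .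
  have qc: "q e \<in> carrier Q" if "e \<in> E" for e
    using cont_homD(1)[OF \<pi> tc[OF that]] by (simp add: q_def)
  have relQ: "\<alpha> (tail X e) (bd0 \<G> e g) = q e \<otimes>\<^bsub>Q\<^esub> \<beta> e g \<otimes>\<^bsub>Q\<^esub> inv\<^bsub>Q\<^esub> (q e)"
    if e: "e \<in> E" and g: "g \<in> carrier (egroup \<G> e)" for e g
  proof -
    have "\<nu>V (head X e) (bd1 \<G> e g) \<in> carrier \<Gamma>"
      using cont_homD(1)[OF \<nu>V[OF vE(2)[OF e]] cont_homD(1)[OF bd(2)[OF e] g]] .
    then show ?thesis
      using rel[OF e g] tc[OF e] cont_homD(1,2)[OF \<pi>]
        cont_hom_group(2)[OF \<pi> \<Gamma>.group_axioms Q.group_axioms]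
      by (simp add: \<alpha>_def \<beta>_def q_def)
  qed
  define B where "B = (\<lambda>v. \<alpha> v ` carrier (vgroup \<G> v))"
  \<comment> \<open>The edge group is mapped through its head, because it is
    \<open>\<beta> e g\<close> that acts in the invariance condition of
    \<open>coboundary_conj\<close>.\<close>
  define C where "C = (\<lambda>e. \<beta> e ` carrier (egroup \<G> e))"
  have subB: "subgroup (B v) Q" if "v \<in> V" for v
    unfolding B_def
    using cont_hom_img_subgroup[OF \<alpha>[OF that] pro_p_groupD(1)[OF ppV[OF that]] Q.group_axioms] .
  have subC: "subgroup (C e) Q" if "e \<in> E" for e
    unfolding C_def
    using cont_hom_img_subgroup[OF \<beta>[OF that] pro_p_groupD(1)[OF bd(3)[OF that]] Q.group_axioms] .
  \<comment> \<open>Conjugation by \<open>q e\<close> carries the image through the head to the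
    image through the tail, which is that of \<open>\<nu>E e\<close>.\<close>
  have cardC: "card (\<pi> ` \<nu>E e ` carrier (egroup \<G> e)) = card (C e)" if e: "e \<in> E" for e
  proof -
    have "\<pi> ` \<nu>E e ` carrier (egroup \<G> e) = (\<lambda>x. q e \<otimes>\<^bsub>Q\<^esub> x \<otimes>\<^bsub>Q\<^esub> inv\<^bsub>Q\<^esub> (q e)) ` C e"
      using rel(1)[OF e] relQ[OF e] by (auto simp: C_def image_image \<alpha>_def intro!: image_cong)
    moreover have "inj_on (\<lambda>x. q e \<otimes>\<^bsub>Q\<^esub> x \<otimes>\<^bsub>Q\<^esub> inv\<^bsub>Q\<^esub> (q e)) (C e)"
    proof (rule inj_onI)
      fix x y assume xy: "x \<in> C e" "y \<in> C e"
        "q e \<otimes>\<^bsub>Q\<^esub> x \<otimes>\<^bsub>Q\<^esub> inv\<^bsub>Q\<^esub> (q e) = q e \<otimes>\<^bsub>Q\<^esub> y \<otimes>\<^bsub>Q\<^esub> inv\<^bsub>Q\<^esub> (q e)"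
      then have "x \<in> carrier Q" "y \<in> carrier Q" using subgroup.subset[OF subC[OF e]] by auto
      then show "x = y" using xy(3) qc[OF e] by simp
    qed
    ultimately show ?thesis by (simp add: card_image)
  qed

  \<comment> \<open>The linear system over the integers modulo p\<close>
  define rV where "rV = (\<lambda>v. coset_rep Q (B v))"
  define rE where "rE = (\<lambda>e. coset_rep Q (C e))"
  \<comment> \<open>The unknowns: a function on \<open>Q\<close> for every vertex and for every edge
    outside the tree.\<close>
  define I where "I = (V <+> (E - arcs T)) \<times> carrier Q"
  \<comment> \<open>A function is constant on the cosets of \<open>C e\<close> iff its value at each
    non-representative agrees with that at the representative, which makes |Q| - |Q| / |C e|
    congruences for \<open>e\<close>.\<close>
  define J where "J = (SIGMA e:E. carrier Q - rE e ` carrier Q)"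
  define \<tau> where "\<tau> = (\<lambda>(a :: ('v + 'e) \<times> 'q \<Rightarrow> int) e x. if e \<in> arcs T then 0 else a (Inr e, x))"
  \<comment> \<open>\<open>D a e\<close> is invariant under \<open>C e\<close> iff the data \<open>a\<close> satisfy the relation of a specialisation at \<open>e\<close>\<close>
  define D where "D = (\<lambda>a e x. a (Inl (tail X e), q e \<otimes>\<^bsub>Q\<^esub> x) - \<tau> a e x - a (Inl (head X e), x))"
  define A where "A = I \<rightarrow>\<^sub>E {0..<int p}"
  define K where "K = {a \<in> A. \<forall>(e, x)\<in>J. (D a e x - D a e (rE e x)) mod int p = 0}"
  have finI: "finite I" and finJ: "finite J" using finV finE finQ by (auto simp: I_def J_def)
  have rEc: "rE e x \<in> carrier Q" if "e \<in> E" "x \<in> carrier Q" for e x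
    using Q.coset_rep(2)[OF subC[OF that(1)] that(2)] by (simp add: rE_def)
  have "p ^ card I \<le> p ^ card J * card {a \<in> I \<rightarrow>\<^sub>E {0..<int p}.
      \<forall>j\<in>J. (case j of (e, x) \<Rightarrow> D a e x - D a e (rE e x)) mod int p = 0}"
  proof (rule card_kernel_congruences[OF finI finJ p0(1)])
    fix a b j assume j: "j \<in> J"
    obtain e x where ex: "j = (e, x)" "e \<in> E" "x \<in> carrier Q" using j by (auto simp: J_def)
    define c where "c = (\<lambda>i\<in>I. (a i - b i) mod int p)"
    have c: "int p dvd c i - (a i - b i)" if "i \<in> I" for i
      using that by (simp add: c_def flip: mod_eq_dvd_iff)
    \<comment> \<open>\<open>c\<close> agrees with a - b only modulo p, so the linearity of
      \<open>D\<close> takes the form of a divisibility.\<close>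
    have cong: "int p dvd D c e y - (D a e y - D b e y)" if y: "y \<in> carrier Q" for y
    proof -
      let ?d = "\<lambda>i. c i - (a i - b i)"
      have tl: "int p dvd ?d (Inl (tail X e), q e \<otimes>\<^bsub>Q\<^esub> y)" and hd: "int p dvd ?d (Inl (head X e), y)"
        using vE[OF ex(2)] qc[OF ex(2)] y by (auto intro!: c simp: I_def)
      have st: "int p dvd \<tau> c e y - (\<tau> a e y - \<tau> b e y)"
        using ex(2) y by (auto intro!: c simp: I_def \<tau>_def)
      have "D c e y - (D a e y - D b e y) = ?d (Inl (tail X e), q e \<otimes>\<^bsub>Q\<^esub> y) -
          (\<tau> c e y - (\<tau> a e y - \<tau> b e y)) - ?d (Inl (head X e), y)"
        by (simp add: D_def)
      then show ?thesis using dvd_diff[OF dvd_diff[OF tl st] hd] by simp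
    qed
    have "int p dvd (D c e x - (D a e x - D b e x)) - (D c e (rE e x) - (D a e (rE e x) - D b e (rE e x)))"
      by (intro dvd_diff cong rEc ex)
    then show "(case j of (e, x) \<Rightarrow> D (\<lambda>i\<in>I. (a i - b i) mod int p) e x - D (\<lambda>i\<in>I. (a i - b i) mod int p) e (rE e x)) mod int p =
      ((case j of (e, x) \<Rightarrow> D a e x - D a e (rE e x)) - (case j of (e, x) \<Rightarrow> D b e x - D b e (rE e x))) mod int p"
      by (simp add: ex(1) mod_eq_dvd_iff algebra_simps flip: c_def)
  qed
  then have lower: "p ^ card I \<le> p ^ card J * card K" by (simp add: K_def A_def case_prod_beta)
  have KA: "a i \<in> {0..<int p}" if "a \<in> K" "i \<in> I" for a i using that by (auto simp: K_def A_def)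
  have inv: "D a e (b \<otimes>\<^bsub>Q\<^esub> x) mod int p = D a e x mod int p"
    if a: "a \<in> K" and e: "e \<in> E" and x: "x \<in> carrier Q" and b: "b \<in> C e" for a e x b
  proof -
    have rr: "rE e (b \<otimes>\<^bsub>Q\<^esub> x) = rE e x" if "b \<in> C e" "x \<in> carrier Q" for b x
      using Q.coset_rep_mult[OF subC[OF e]] that by (simp add: rE_def)
    \<comment> \<open>Outside \<open>J\<close> the point is itself a representative, and
      \<open>rE e\<close> fixes it.\<close>
    have rep: "D a e y mod int p = D a e (rE e y) mod int p" if y: "y \<in> carrier Q" for y
    proof (cases "(e, y) \<in> J")
      case True
      then show ?thesis using a by (auto simp: K_def mod_eq_dvd_iff)
    next
      case False
      then obtain z where z: "z \<in> carrier Q" "y = rE e z" using e y by (auto simp: J_def)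
      then obtain h where "h \<in> C e" "y = h \<otimes>\<^bsub>Q\<^esub> z" using Q.coset_rep(1)[OF subC[OF e]] by (auto simp: rE_def)
      then have "rE e y = y" using rr z by simp
      then show ?thesis by simp
    qed
    have "b \<in> carrier Q" using b subgroup.subset[OF subC[OF e]] by auto
    then show ?thesis using rep[of x] rep[of "b \<otimes>\<^bsub>Q\<^esub> x"] rr[OF b x] x by simp
  qed

  \<comment> \<open>Lifts of \<open>\<pi>\<close> to the wreath product\<close>
  define \<beta>V where "\<beta>V = (\<lambda>(a :: ('v + 'e) \<times> 'q \<Rightarrow> int) v g. coboundary p Q (\<lambda>x. a (Inl v, x)) (\<alpha> v g))"
  \<comment> \<open>The relation at the tail dictates the edge maps, so only the relation at the
    head (\<open>R1\<close>) has to be verified.\<close>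
  define \<beta>E where "\<beta>E = (\<lambda>a e g. \<beta>V a (tail X e) (bd0 \<G> e g))"
  define s where "s = (\<lambda>a e. (\<lambda>x\<in>carrier Q. \<tau> a e x, q e))"
  have spec: "specialisation p \<G> T P (\<beta>V a) (\<beta>E a) (s a)" if a: "a \<in> K" for a
  proof -
    have V1: "\<beta>V a v \<in> cont_hom (vgroup \<G> v) P" if v: "v \<in> V" for v
    proof -
      have "coboundary p Q (\<lambda>x. a (Inl v, x)) \<in> cont_hom Q P"
        unfolding P_def using pro_p_groupD(2)[OF ppP]
        by (intro cont_hom_from_discrete coboundary_hom Q(2) p0 Q.group_axioms) (simp add: P_def)
      from cont_hom_compose[OF \<alpha>[OF v] this] show ?thesis unfolding \<beta>V_def .
    qed
    have E1: "\<beta>E a e \<in> cont_hom (egroup \<G> e) P" if e: "e \<in> E" for e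
      unfolding \<beta>E_def using cont_hom_compose[OF bd(1)[OF e] V1[OF vE(1)[OF e]]] .
    have s1: "s a e \<in> carrier P" if e: "e \<in> E" for e
    proof -
      have "\<tau> a e x \<in> {0..<int p}" if "x \<in> carrier Q" for x
        using KA[OF a, of "(Inr e, x)"] that e p0 by (auto simp: \<tau>_def I_def)
      then show ?thesis using qc[OF e] by (auto simp: s_def P_def wreath_simps)
    qed
    have sT: "s a e = \<one>\<^bsub>P\<^esub>" if "e \<in> arcs T" for e
      using that tT[OF that] cont_hom_group(1)[OF \<pi> \<Gamma>.group_axioms Q.group_axioms]
      by (simp add: s_def P_def wreath_simps \<tau>_def q_def cong: restrict_cong)
    have R1: "\<beta>E a e g = s a e \<otimes>\<^bsub>P\<^esub> \<beta>V a (head X e) (bd1 \<G> e g) \<otimes>\<^bsub>P\<^esub> inv\<^bsub>P\<^esub> (s a e)"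
      if e: "e \<in> E" and g: "g \<in> carrier (egroup \<G> e)" for e g
    proof -
      let ?a = "\<alpha> (tail X e) (bd0 \<G> e g)"
      have b: "\<beta> e g \<in> carrier Q" using cont_homD(1)[OF \<beta>[OF e] g] .
      have ac: "?a \<in> carrier Q"
        using cont_homD(1)[OF \<alpha>[OF vE(1)[OF e]] cont_homD(1)[OF bd(1)[OF e] g]] .
      have "?a \<otimes>\<^bsub>Q\<^esub> q e = q e \<otimes>\<^bsub>Q\<^esub> \<beta> e g"
        using relQ[OF e g] b qc[OF e] by (simp add: Q.m_assoc)
      then have "coboundary p Q (\<lambda>x. a (Inl (tail X e), x)) ?a \<otimes>\<^bsub>P\<^esub> s a e =
          s a e \<otimes>\<^bsub>P\<^esub> coboundary p Q (\<lambda>x. a (Inl (head X e), x)) (\<beta> e g)"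
        unfolding P_def s_def
      proof (rule coboundary_conj[OF Q.group_axioms qc[OF e] b ac])
        fix x assume x: "x \<in> carrier Q"
        have "\<beta> e g \<in> C e" using g by (simp add: C_def)
        from inv[OF a e x this] b x
        show "(a (Inl (tail X e), q e \<otimes>\<^bsub>Q\<^esub> (\<beta> e g \<otimes>\<^bsub>Q\<^esub> x)) - (\<lambda>x\<in>carrier Q. \<tau> a e x) (\<beta> e g \<otimes>\<^bsub>Q\<^esub> x) -
            a (Inl (head X e), \<beta> e g \<otimes>\<^bsub>Q\<^esub> x)) mod int p =
          (a (Inl (tail X e), q e \<otimes>\<^bsub>Q\<^esub> x) - (\<lambda>x\<in>carrier Q. \<tau> a e x) x - a (Inl (head X e), x)) mod int p"
          by (simp add: D_def)
      qed
      then have eq: "\<beta>E a e g \<otimes>\<^bsub>P\<^esub> s a e = s a e \<otimes>\<^bsub>P\<^esub> \<beta>V a (head X e) (bd1 \<G> e g)"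
        by (simp add: \<beta>E_def \<beta>V_def \<beta>_def)
      have "\<beta>E a e g \<in> carrier P" "s a e \<in> carrier P"
        using cont_homD(1)[OF E1[OF e] g] s1[OF e] .
      then show ?thesis using eq by (metis P.inv_closed P.m_assoc P.r_inv P.r_one)
    qed
    show ?thesis
      unfolding specialisation_def
      using ppP V1 E1 s1 sT R1 by (auto simp: \<beta>E_def V_def E_def X_def)
  qed
  have "\<exists>\<phi>. spec_morphism \<G> \<Gamma> \<nu>V \<nu>E t P (\<beta>V a) (\<beta>E a) (s a) \<phi>" if "a \<in> K" for a
    using universal_property[OF p \<G> T \<Gamma> spec[OF that]] by blast
  then obtain \<phi> where \<phi>: "\<And>a. a \<in> K \<Longrightarrow> spec_morphism \<G> \<Gamma> \<nu>V \<nu>E t P (\<beta>V a) (\<beta>E a) (s a) (\<phi> a)"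
    by metis
  have \<phi>h: "\<phi> a \<in> cont_hom \<Gamma> P" if "a \<in> K" for a using \<phi>[OF that] by (simp add: spec_morphism_def)
  have sndP: "snd \<in> cont_hom P Q"
    using cont_hom_from_discrete[OF snd_wreath_hom wreath_simps(4) pro_p_groupD(2)[OF Q(1)]]
    by (simp add: P_def)
  \<comment> \<open>By uniqueness of the morphism to \<open>Q\<close>, each \<open>\<phi> a\<close>
    lifts \<open>\<pi>\<close>. On a generator only the first component is then free, which leaves
    p^|Q| values.\<close>
  have \<phi>snd: "snd (\<phi> a h) = \<pi> h" if a: "a \<in> K" and h: "h \<in> carrier \<Gamma>" for a h
  proof -
    let ?sm = "spec_morphism \<G> \<Gamma> \<nu>V \<nu>E t Q (\<lambda>v x. \<pi> (\<nu>V v x)) (\<lambda>e x. \<pi> (\<nu>E e x)) (\<lambda>e. \<pi> (t e))"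
    have "?sm \<pi>" using \<pi> by (simp add: spec_morphism_def)
    moreover have "?sm (\<lambda>x. snd (\<phi> a x))"
    proof -
      have "\<pi> (\<nu>E e x) = \<alpha> (tail X e) (bd0 \<G> e x)" if "e \<in> E" "x \<in> carrier (egroup \<G> e)" for e x
        using rel(1)[OF that] by (simp add: \<alpha>_def)
      then show ?thesis
        using \<phi>[OF a] cont_hom_compose[OF \<phi>h[OF a] sndP]
        by (simp add: spec_morphism_def \<beta>E_def \<beta>V_def s_def coboundary_def \<alpha>_def q_def E_def X_def)
    qed
    moreover have "specialisation p \<G> T Q (\<lambda>v x. \<pi> (\<nu>V v x)) (\<lambda>e x. \<pi> (\<nu>E e x)) (\<lambda>e. \<pi> (t e))"
      using specialisation_compose[OF \<G> _ sp Q(1) \<pi>] ET(2) by (simp add: E_def X_def)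
    ultimately show ?thesis using universal_property[OF p \<G> T \<Gamma>] h by metis
  qed

  \<comment> \<open>Recovering a solution from its lift\<close>
  define W where "W = (SIGMA v:V. rV v ` carrier Q)"
  \<comment> \<open>The lift determines the function at a vertex \<open>v\<close> only up to
    functions invariant under \<open>B v\<close>; its values at the representatives, indexed by
    \<open>W\<close>, settle the rest.\<close>
  define F where "F = (\<lambda>a. (\<lambda>x\<in>S. fst (\<phi> a x), \<lambda>(v, x)\<in>W. a (Inl v, x)))"
  let ?R = "(S \<rightarrow>\<^sub>E (carrier Q \<rightarrow>\<^sub>E {0..<int p})) \<times> (W \<rightarrow>\<^sub>E {0..<int p})"
  have S\<Gamma>: "S \<subseteq> carrier \<Gamma>" using S(2) by (simp add: top_generates_def)
  have rVc: "rV v x \<in> carrier Q" if "v \<in> V" "x \<in> carrier Q" for v x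
    using Q.coset_rep(2)[OF subB[OF that(1)] that(2)] by (simp add: rV_def)
  have FR: "F a \<in> ?R" if a: "a \<in> K" for a
  proof -
    have "fst (\<phi> a x) \<in> carrier Q \<rightarrow>\<^sub>E {0..<int p}" if "x \<in> S" for x
      using cont_homD(1)[OF \<phi>h[OF a] subsetD[OF S\<Gamma> that]]
      unfolding P_def wreath_simps mem_Times_iff by blast
    moreover have "a (Inl v, x) \<in> {0..<int p}" if "(v, x) \<in> W" for v x
      using that rVc by (intro KA[OF a]) (auto simp: W_def I_def)
    ultimately show ?thesis
      unfolding F_def mem_Times_iff fst_conv snd_conv
      by (intro conjI restrict_PiE_iff[THEN iffD2]) (auto simp del: PiE_iff atLeastLessThan_iff)
  qed
  have Finj: "inj_on F K"
  proof (rule inj_onI)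
    fix a b assume a: "a \<in> K" and b: "b \<in> K" and eq: "F a = F b"
    have eq1: "fst (\<phi> a x) = fst (\<phi> b x)" if "x \<in> S" for x
      using fun_cong[OF arg_cong[OF eq, of fst], of x] that by (simp add: F_def)
    have eq2: "a (Inl v, x) = b (Inl v, x)" if "(v, x) \<in> W" for v x
      using fun_cong[OF arg_cong[OF eq, of snd], of "(v, x)"] that by (simp add: F_def)
    have "\<phi> a x = \<phi> b x" if "x \<in> S" for x
      using eq1[OF that] \<phi>snd a b that S\<Gamma> by (metis prod.expand subsetD)
    then have \<phi>eq: "\<phi> a x = \<phi> b x" if "x \<in> carrier \<Gamma>" for x
      using cont_hom_eq_on_generators[OF pp\<Gamma> ppP \<phi>h[OF a] \<phi>h[OF b] S(2)] that by blast
    have Veq: "a (Inl v, x) = b (Inl v, x)" if v: "v \<in> V" and x: "x \<in> carrier Q" for v x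
    proof -
      \<comment> \<open>The derivation at an element carrying \<open>x\<close> to its representative
        is the difference of the values at the two points.\<close>
      obtain h where h: "h \<in> B v" "rV v x = h \<otimes>\<^bsub>Q\<^esub> x"
        using Q.coset_rep(1)[OF subB[OF v] x] by (auto simp: rV_def)
      then obtain g where g: "g \<in> carrier (vgroup \<G> v)" "h = \<alpha> v g" by (auto simp: B_def)
      have "\<nu>V v g \<in> carrier \<Gamma>" using cont_homD(1)[OF \<nu>V[OF v] g(1)] .
      then have "\<beta>V a v g = \<beta>V b v g"
        using \<phi>eq \<phi>[OF a] \<phi>[OF b] v g(1) by (metis V_def X_def spec_morphism_def)
      from fun_cong[OF arg_cong[OF this, of fst], of x]
      have "(a (Inl v, h \<otimes>\<^bsub>Q\<^esub> x) - a (Inl v, x)) mod int p =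
          (b (Inl v, h \<otimes>\<^bsub>Q\<^esub> x) - b (Inl v, x)) mod int p"
        using x by (simp add: \<beta>V_def coboundary_def g(2))
      moreover have "a (Inl v, h \<otimes>\<^bsub>Q\<^esub> x) = b (Inl v, h \<otimes>\<^bsub>Q\<^esub> x)"
      proof -
        have "(v, rV v x) \<in> W" using v x by (auto simp: W_def)
        from eq2[OF this] show ?thesis by (simp add: h(2))
      qed
      ultimately have "b (Inl v, x) mod int p = a (Inl v, x) mod int p"
        by (simp add: mod_eq_dvd_iff)
      then show ?thesis
        using KA[OF a, of "(Inl v, x)"] KA[OF b, of "(Inl v, x)"] v x by (simp add: I_def InlI)
    qed
    have Eeq: "a (Inr e, x) = b (Inr e, x)" if e: "e \<in> E - arcs T" and x: "x \<in> carrier Q" for e x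
    proof -
      have "s a e = s b e"
        using \<phi>eq[OF tc[of e]] \<phi>[OF a] \<phi>[OF b] e by (auto simp: spec_morphism_def E_def X_def)
      from fun_cong[OF arg_cong[OF this, of fst], of x] show ?thesis
        using e x by (simp add: s_def \<tau>_def)
    qed
    show "a = b"
    proof (rule PiE_ext)
      show "a \<in> I \<rightarrow>\<^sub>E {0..<int p}" "b \<in> I \<rightarrow>\<^sub>E {0..<int p}" using a b by (auto simp: K_def A_def)
      show "a i = b i" if "i \<in> I" for i using that Veq Eeq by (auto simp: I_def)
    qed
  qed
  have finW: "finite W" using finV finQ by (auto simp: W_def)
  have "finite ?R" using finW finQ S(1) by (intro finite_cartesian_product finite_PiE) auto
  then have "card K \<le> card ?R" using FR by (intro card_inj_on_le[OF Finj] image_subsetI)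
  also have "\<dots> = p ^ (order Q * card S + card W)"
    using finW finQ S(1) by (simp add: card_cartesian_product card_PiE order_def power_add power_mult)
  finally have "p ^ card I \<le> p ^ (card J + (order Q * card S + card W))"
    using lower by (metis (no_types, lifting) le_trans mult_le_mono2 power_add)
  \<comment> \<open>Unknowns on the left; on the right the congruences and the values that pin down
    a solution.\<close>
  then have main: "card I \<le> card J + (order Q * card S + card W)"
    using p0(2) by simp

  \<comment> \<open>Comparison of exponents\<close>
  have o: "order Q > 0" using n p0 by simp
  have ratio: "real k = real (order Q) * (1 / real l)" if "k * l = order Q" for k l
  proof -
    have "real k * real l = real (order Q)" using that by (simp flip: of_nat_mult)
    moreover have "l > 0" using that o by (cases l) auto
    ultimately show ?thesis by (simp add: field_simps)
  qed
  have cI: "real (card I) = (real (card V) + real (card E) - real (card (arcs T))) * real (order Q)"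
    using finV finE ET card_Diff_subset[OF finite_subset[OF ET(2) finE] ET(2)] card_mono[OF finE ET(2)]
    by (simp add: I_def card_cartesian_product card_Plus order_def of_nat_diff)
  have cW: "real (card W) = (\<Sum>v\<in>V. real (order Q) * (1 / real (card (B v))))"
  proof -
    have "card (rV v ` carrier Q) * card (B v) = order Q" if "v \<in> V" for v
      using Q.card_coset_reps[OF subB[OF that] finQ] by (simp add: rV_def)
    then have "real (card (rV v ` carrier Q)) = real (order Q) * (1 / real (card (B v)))" if "v \<in> V" for v
      using ratio that by blast
    then show ?thesis using finV finQ by (simp add: W_def)
  qed
  have cJ: "real (card J) = (\<Sum>e\<in>E. real (order Q) - real (order Q) * (1 / real (card (C e))))"
  proof -
    have "card (rE e ` carrier Q) * card (C e) = order Q" if "e \<in> E" for e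
      using Q.card_coset_reps[OF subC[OF that] finQ] by (simp add: rE_def)
    then have 1: "real (card (rE e ` carrier Q)) = real (order Q) * (1 / real (card (C e)))" if "e \<in> E" for e
      using ratio that by blast
    have "real (card (carrier Q - rE e ` carrier Q)) = real (order Q) - real (order Q) * (1 / real (card (C e)))"
      if "e \<in> E" for e
    proof -
      have sub: "rE e ` carrier Q \<subseteq> carrier Q" using rEc that by blast
      then show ?thesis
        using card_Diff_subset[OF finite_subset[OF sub finQ] sub] card_mono[OF finQ sub] 1[OF that]
        by (simp add: order_def of_nat_diff)
    qed
    then show ?thesis using finE finQ by (simp add: J_def)
  qed
  have "real (card I) \<le> real (card J) + (real (order Q) * real (card S) + real (card W))"
    using main by (simp flip: of_nat_add of_nat_mult)
  then have "(real (card V) - real (card (arcs T))) * real (order Q) +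
      real (order Q) * (\<Sum>e\<in>E. 1 / real (card (C e)))
      \<le> real (order Q) * real (card S) + real (order Q) * (\<Sum>v\<in>V. 1 / real (card (B v)))"
    unfolding cI cJ cW by (simp add: sum_subtractf sum_distrib_left algebra_simps)
  then have "real (order Q) * ((real (card V) - real (card (arcs T))) + (\<Sum>e\<in>E. 1 / real (card (C e))))
      \<le> real (order Q) * (real (card S) + (\<Sum>v\<in>V. 1 / real (card (B v))))"
    by (simp only: distrib_left mult.commute[of "real (order Q)"])
  then have "(real (card V) - real (card (arcs T))) + (\<Sum>e\<in>E. 1 / real (card (C e)))
      \<le> real (card S) + (\<Sum>v\<in>V. 1 / real (card (B v)))"
    using o by simp
  \<comment> \<open>The surplus of vertices over tree edges yields the -1 of the bound.\<close>
  moreover have "real (card V) - real (card (arcs T)) \<ge> 1" using ET(1) by linarith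
  moreover have "(\<Sum>e\<in>E. 1 / real (card (C e))) = (\<Sum>e\<in>E. 1 / real (card (\<pi> ` \<nu>E e ` carrier (egroup \<G> e))))"
    using cardC by simp
  moreover have "(\<Sum>v\<in>V. 1 / real (card (B v))) = (\<Sum>v\<in>V. 1 / real (card (\<pi> ` \<nu>V v ` carrier (vgroup \<G> v))))"
    by (simp add: B_def \<alpha>_def image_image)
  ultimately show ?thesis by (simp add: V_def E_def X_def)
qed


text \<open>A continuous bijection from a compact space to a Hausdorff space is a homeomorphism, so
  an injective homomorphism can fail to be an isomorphism only by missing an element.\<close>

lemma cont_hom_not_top_iso:
  assumes A: "pro_p_group p A" and B: "pro_p_group p B" and f: "f \<in> cont_hom A B"
    and inj: "inj_on f (carrier A)" and not_iso: "f \<notin> top_iso A B"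
  shows "\<exists>y\<in>carrier B. y \<notin> f ` carrier A"
proof (rule ccontr)
  assume "\<not> ?thesis"
  then have img: "f ` carrier A = carrier B" using cont_homD(1)[OF f] by blast
  have "homeomorphic_map (gtop A) (gtop B) f"
    using cont_homD(3)[OF f] pro_p_groupD(2,3)[OF A] pro_p_groupD(2,4)[OF B] img inj
    by (intro continuous_imp_homeomorphic_map) auto
  moreover have "f \<in> iso A B" using f img inj by (simp add: iso_def bij_betw_def cont_hom_def)
  ultimately show False using not_iso by (simp add: top_iso_def)
qed

text \<open>Both images are subgroups of a finite p-group and have p-power orders; the strict
  inclusion witnessed by \<open>y\<close> therefore costs a factor of at least p.\<close>

lemma card_proper_image:
  assumes p: "prime p" and Q: "pro_p_group p Q" "gtop Q = discrete_topology (carrier Q)"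
    and A: "Group.group A" and B: "Group.group B"
    and f: "f \<in> cont_hom A B" and h: "h \<in> cont_hom B Q"
    and inj: "inj_on (\<lambda>x. h (f x)) (carrier A)"
    and y: "y \<in> carrier B" "\<And>x. x \<in> carrier A \<Longrightarrow> h y \<noteq> h (f x)"
  shows "p * card (carrier A) \<le> card (h ` carrier B)"
proof -
  interpret Q: Group.group Q using pro_p_groupD(1)[OF Q(1)] .
  note fin = order_pro_p_group_discrete(1)[OF p Q]
  obtain n where n: "order Q = p ^ n" using order_pro_p_group_discrete(2)[OF p Q] by blast
  let ?H = "(\<lambda>x. h (f x)) ` carrier A" and ?K = "h ` carrier B"
  have H: "subgroup ?H Q" using cont_hom_img_subgroup[OF cont_hom_compose[OF f h] A Q.group_axioms] .
  have K: "subgroup ?K Q" using cont_hom_img_subgroup[OF h B Q.group_axioms] .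
  have pow: "\<exists>k. card L = p ^ k" if "subgroup L Q" for L
    using Q.lagrange[OF that] n p by (metis divides_primepow_nat dvd_triv_right)
  obtain i j where ij: "card ?H = p ^ i" "card ?K = p ^ j" using pow H K by blast
  have "?H \<subset> ?K" using y cont_homD(1)[OF f] by blast
  then have "card ?H < card ?K"
    using finite_subset[OF subgroup.subset[OF K] fin] by (intro psubset_card_mono) auto
  then have "i < j" using ij p prime_gt_1_nat power_strict_increasing_iff by metis
  then have "p ^ Suc i \<le> p ^ j" using p prime_gt_0_nat by (intro power_increasing) (auto simp: Suc_leI)
  then show ?thesis using ij card_image[OF inj] by simp
qed

theorem theorem3p1:
  fixes p :: nat and K :: int
    and G :: "'g top_group" and \<Gamma> :: "'h top_group"
    and \<G> :: "('v, 'e, 'a, 'b) graph_of_groups" and T :: "('v, 'e) pre_digraph"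
    and \<nu>V :: "'v \<Rightarrow> 'a \<Rightarrow> 'h" and \<nu>E :: "'e \<Rightarrow> 'b \<Rightarrow> 'h" and t :: "'e \<Rightarrow> 'h"
  assumes "prime p"
    and "pro_p_group p G" and "top_finitely_generated G"
    and "graph_of_pro_p_groups p \<G>" and "reduced_graph_of_groups \<G>"
    and "maximal_subtree (base \<G>) T"
    and "pro_p_fundamental_group p \<G> T \<Gamma> \<nu>V \<nu>E t"
    and "proper \<G> \<nu>V \<nu>E"
    and "top_iso \<Gamma> G \<noteq> {}"
    and "\<forall>e\<in>arcs (base \<G>). finite (carrier (egroup \<G> e)) \<and> int (card (carrier (egroup \<G> e))) \<le> K"
    and edgeless: "arcs (base \<G>) = {} \<Longrightarrow> 0 \<le> K \<and> carrier G \<noteq> {\<one>\<^bsub>G\<^esub>}"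
  shows "real (card (arcs (base \<G>)))
           \<le> real p * real_of_int K / (real p - 1) * (real (rk G) - 1) + 1"
proof (cases "arcs (base \<G>) = {}")
  case True
  \<comment> \<open>For K >= 0 and rk(G) >= 1 the right-hand side is at least 1, so it bounds the
    zero edges.\<close>
  then have "rk G > 0" "K \<ge> 0" using edgeless rk_pos assms(2,3) by blast+
  moreover have "p > 1" using assms(1) by (rule prime_gt_1_nat)
  ultimately have "real p * real_of_int K / (real p - 1) * (real (rk G) - 1) \<ge> 0" by simp
  then show ?thesis using True by simp
next
  case False
  note p = assms(1) and \<G> = assms(4) and \<Gamma> = assms(7)

  \<comment> \<open>Structure maps into \<open>\<Gamma>\<close>\<close>
  define X where "X = base \<G>"
  have ne: "arcs X \<noteq> {}" using False by (simp add: X_def)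
  have fin: "fin_digraph X" and conn: "Digraph_Component.connected X"
    using \<G> by (simp_all add: graph_of_pro_p_groups_def X_def)
  interpret X: fin_digraph X by fact
  let ?A = "\<lambda>e. egroup \<G> e" and ?B = "\<lambda>v. vgroup \<G> v"
  have p1: "p > 1" using p by (rule prime_gt_1_nat)
  have sp: "specialisation p \<G> T \<Gamma> \<nu>V \<nu>E t" using \<Gamma> by (simp add: pro_p_fundamental_group_def)
  have pp\<Gamma>: "pro_p_group p \<Gamma>" using sp by (simp add: specialisation_def)
  interpret \<Gamma>: Group.group \<Gamma> using pro_p_groupD(1)[OF pp\<Gamma>] .
  have \<nu>V: "\<nu>V v \<in> cont_hom (?B v) \<Gamma>" "inj_on (\<nu>V v) (carrier (?B v))" if "v \<in> verts X" for v
    using sp assms(8) that by (simp_all add: specialisation_def proper_def X_def)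
  have \<nu>E: "\<nu>E e \<in> cont_hom (?A e) \<Gamma>" "inj_on (\<nu>E e) (carrier (?A e))" "t e \<in> carrier \<Gamma>"
    if "e \<in> arcs X" for e
    using sp assms(8) that by (simp_all add: specialisation_def proper_def X_def)
  have bd: "bd0 \<G> e \<in> cont_hom (?A e) (?B (tail X e))" "inj_on (bd0 \<G> e) (carrier (?A e))"
    "bd1 \<G> e \<in> cont_hom (?A e) (?B (head X e))" "inj_on (bd1 \<G> e) (carrier (?A e))"
    and ppA: "pro_p_group p (?A e)" if "e \<in> arcs X" for e
    using \<G> that by (simp_all add: graph_of_pro_p_groups_def X_def)
  have ppB: "pro_p_group p (?B v)" if "v \<in> verts X" for v
    using \<G> that by (simp add: graph_of_pro_p_groups_def X_def)
  have rel: "\<nu>V (tail X e) (bd0 \<G> e g) = \<nu>E e g"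
    "\<nu>E e g = t e \<otimes>\<^bsub>\<Gamma>\<^esub> \<nu>V (head X e) (bd1 \<G> e g) \<otimes>\<^bsub>\<Gamma>\<^esub> inv\<^bsub>\<Gamma>\<^esub> (t e)"
    if "e \<in> arcs X" "g \<in> carrier (?A e)" for e g
    using sp that by (auto simp: specialisation_def X_def)
  have finA: "finite (carrier (?A e))" and cardK: "int (card (carrier (?A e))) \<le> K" if "e \<in> arcs X" for e
    using assms(10) that by (simp_all add: X_def)

  \<comment> \<open>A finite quotient separating the relevant elements\<close>
  define E' where "E' = {e \<in> arcs X. tail X e \<noteq> head X e}"
  have E': "e \<in> arcs X" "tail X e \<in> verts X" "head X e \<in> verts X" if "e \<in> E'" for e
    using that by (auto simp: E'_def)
  \<comment> \<open>Reducedness leaves room outside the edge group at both ends of a non-loop;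
    \<open>y0 e\<close> and \<open>y1 e\<close> are chosen there and will witness this in the
    quotient too.\<close>
  have "\<exists>y\<in>carrier (?B (tail X e)). y \<notin> bd0 \<G> e ` carrier (?A e)" if e: "e \<in> E'" for e
    using assms(5) e E'[OF e] by (intro cont_hom_not_top_iso[OF ppA ppB] bd)
      (auto simp: reduced_graph_of_groups_def E'_def X_def)
  then obtain y0 where y0: "\<And>e. e \<in> E' \<Longrightarrow> y0 e \<in> carrier (?B (tail X e)) \<and> y0 e \<notin> bd0 \<G> e ` carrier (?A e)"
    by metis
  have "\<exists>y\<in>carrier (?B (head X e)). y \<notin> bd1 \<G> e ` carrier (?A e)" if e: "e \<in> E'" for e
    using assms(5) e E'[OF e] by (intro cont_hom_not_top_iso[OF ppA ppB] bd)
      (auto simp: reduced_graph_of_groups_def E'_def X_def)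
  then obtain y1 where y1: "\<And>e. e \<in> E' \<Longrightarrow> y1 e \<in> carrier (?B (head X e)) \<and> y1 e \<notin> bd1 \<G> e ` carrier (?A e)"
    by metis
  \<comment> \<open>the elements that must stay nontrivial in the finite quotient\<close>
  define F where "F = (\<Union>e\<in>arcs X. \<nu>E e ` (carrier (?A e) - {\<one>\<^bsub>?A e\<^esub>})) \<union>
    (\<Union>e\<in>E'. (\<lambda>g. inv\<^bsub>\<Gamma>\<^esub> (\<nu>V (tail X e) (bd0 \<G> e g)) \<otimes>\<^bsub>\<Gamma>\<^esub> \<nu>V (tail X e) (y0 e)) ` carrier (?A e)) \<union>
    (\<Union>e\<in>E'. (\<lambda>g. inv\<^bsub>\<Gamma>\<^esub> (\<nu>V (head X e) (bd1 \<G> e g)) \<otimes>\<^bsub>\<Gamma>\<^esub> \<nu>V (head X e) (y1 e)) ` carrier (?A e))"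
  have c0: "bd0 \<G> e g \<in> carrier (?B (tail X e))" "bd1 \<G> e g \<in> carrier (?B (head X e))"
    if "e \<in> arcs X" "g \<in> carrier (?A e)" for e g
    using cont_homD(1)[OF bd(1)[OF that(1)] that(2)] cont_homD(1)[OF bd(3)[OF that(1)] that(2)] .
  have cV: "\<nu>V v g \<in> carrier \<Gamma>" if "v \<in> verts X" "g \<in> carrier (?B v)" for v g
    using cont_homD(1)[OF \<nu>V(1)[OF that(1)] that(2)] .
  have cE: "\<nu>E e g \<in> carrier \<Gamma>" if "e \<in> arcs X" "g \<in> carrier (?A e)" for e g
    using cont_homD(1)[OF \<nu>E(1)[OF that(1)] that(2)] .
  have gA: "Group.group (?A e)" if "e \<in> arcs X" for e using pro_p_groupD(1)[OF ppA[OF that]] .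
  have gB: "Group.group (?B v)" if "v \<in> verts X" for v using pro_p_groupD(1)[OF ppB[OF that]] .
  have quot_one: "x = y" if "inv\<^bsub>\<Gamma>\<^esub> x \<otimes>\<^bsub>\<Gamma>\<^esub> y = \<one>\<^bsub>\<Gamma>\<^esub>" "x \<in> carrier \<Gamma>" "y \<in> carrier \<Gamma>" for x y
    using that by (metis \<Gamma>.inv_closed \<Gamma>.inv_equality \<Gamma>.inv_inv)
  have finE': "finite E'" by (simp add: E'_def)
  have "finite F" unfolding F_def using finA E' finE' by (intro finite_UnI finite_UN_I) auto
  moreover have "F \<subseteq> carrier \<Gamma>"
    unfolding F_def using cE cV c0 E' y0 y1 by (auto intro!: \<Gamma>.m_closed \<Gamma>.inv_closed)
  moreover have "\<one>\<^bsub>\<Gamma>\<^esub> \<notin> F"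
  proof
    assume "\<one>\<^bsub>\<Gamma>\<^esub> \<in> F"
    then consider (1) e g where "e \<in> arcs X" "g \<in> carrier (?A e)" "g \<noteq> \<one>\<^bsub>?A e\<^esub>" "\<nu>E e g = \<one>\<^bsub>\<Gamma>\<^esub>"
      | (2) e g where "e \<in> E'" "g \<in> carrier (?A e)"
          "inv\<^bsub>\<Gamma>\<^esub> (\<nu>V (tail X e) (bd0 \<G> e g)) \<otimes>\<^bsub>\<Gamma>\<^esub> \<nu>V (tail X e) (y0 e) = \<one>\<^bsub>\<Gamma>\<^esub>"
      | (3) e g where "e \<in> E'" "g \<in> carrier (?A e)"
          "inv\<^bsub>\<Gamma>\<^esub> (\<nu>V (head X e) (bd1 \<G> e g)) \<otimes>\<^bsub>\<Gamma>\<^esub> \<nu>V (head X e) (y1 e) = \<one>\<^bsub>\<Gamma>\<^esub>"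
      unfolding F_def by (elim UnE UN_E imageE) (metis DiffE singletonI, metis+)
    then show False
    proof cases
      case 1
      have "\<nu>E e \<one>\<^bsub>?A e\<^esub> = \<one>\<^bsub>\<Gamma>\<^esub>"
        using cont_hom_group(1)[OF \<nu>E(1)[OF 1(1)] gA[OF 1(1)] \<Gamma>.group_axioms] .
      then show False
        using inj_onD[OF \<nu>E(2)[OF 1(1)], of g "\<one>\<^bsub>?A e\<^esub>"] 1 Group.group.is_monoid[OF gA[OF 1(1)]]
        by (auto intro: monoid.one_closed)
    next
      case 2
      note e = E'[OF 2(1)]
      have "\<nu>V (tail X e) (bd0 \<G> e g) = \<nu>V (tail X e) (y0 e)"
        using quot_one[OF 2(3)] cV[OF e(2)] c0(1)[OF e(1) 2(2)] y0[OF 2(1)] by blast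
      from inj_onD[OF \<nu>V(2)[OF e(2)] this] have "bd0 \<G> e g = y0 e"
        using c0(1)[OF e(1) 2(2)] y0[OF 2(1)] by blast
      then show False using y0[OF 2(1)] imageI[OF 2(2), of "bd0 \<G> e"] by simp
    next
      case 3
      note e = E'[OF 3(1)]
      have "\<nu>V (head X e) (bd1 \<G> e g) = \<nu>V (head X e) (y1 e)"
        using quot_one[OF 3(3)] cV[OF e(3)] c0(2)[OF e(1) 3(2)] y1[OF 3(1)] by blast
      from inj_onD[OF \<nu>V(2)[OF e(3)] this] have "bd1 \<G> e g = y1 e"
        using c0(2)[OF e(1) 3(2)] y1[OF 3(1)] by blast
      then show False using y1[OF 3(1)] imageI[OF 3(2), of "bd1 \<G> e"] by simp
    qed
  qed
  ultimately obtain N where N: "N \<lhd> \<Gamma>" "openin (gtop \<Gamma>) N" "N \<inter> F = {}"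
    using open_normal_avoiding_finite[OF pp\<Gamma>] by blast
  from finite_quotient[OF p pp\<Gamma> N(1,2)] obtain Q :: "nat set top_group" and \<pi> where
    Q: "pro_p_group p Q" "gtop Q = discrete_topology (carrier Q)" and \<pi>: "\<pi> \<in> cont_hom \<Gamma> Q"
    and ker: "\<And>x. x \<in> carrier \<Gamma> \<Longrightarrow> \<pi> x = \<one>\<^bsub>Q\<^esub> \<longleftrightarrow> x \<in> N" by metis
  interpret Q: Group.group Q using pro_p_groupD(1)[OF Q(1)] .

  \<comment> \<open>Embedding the edge groups in \<open>Q\<close>\<close>
  note \<pi>g = cont_homD(1,2)[OF \<pi>] cont_hom_group[OF \<pi> \<Gamma>.group_axioms Q.group_axioms]
  have F\<pi>: "\<pi> x \<noteq> \<one>\<^bsub>Q\<^esub>" if "x \<in> F" "x \<in> carrier \<Gamma>" for x using ker N(3) that by blast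
  \<comment> \<open>Nontrivial elements of an edge group have their images under
    \<open>\<nu>E e\<close> in \<open>F\<close>, so a homomorphism \<open>f\<close> is injective
    once its kernel dies under \<open>\<pi>\<close> after \<open>\<nu>E e\<close>.\<close>
  have inj: "inj_on (\<lambda>g. f g) (carrier (?A e))"
    if e: "e \<in> arcs X" and f: "f \<in> cont_hom (?A e) Q"
      and one: "\<And>g. g \<in> carrier (?A e) \<Longrightarrow> f g = \<one>\<^bsub>Q\<^esub> \<Longrightarrow> \<pi> (\<nu>E e g) = \<one>\<^bsub>Q\<^esub>" for e f
  proof -
    interpret group_hom "?A e" Q f
      using f gA[OF e] Q.group_axioms by (simp add: group_hom_def group_hom_axioms_def cont_hom_def)
    have "g = \<one>\<^bsub>?A e\<^esub>" if g: "g \<in> carrier (?A e)" "f g = \<one>\<^bsub>Q\<^esub>" for g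
    proof (rule ccontr)
      assume "g \<noteq> \<one>\<^bsub>?A e\<^esub>"
      then have "\<nu>E e g \<in> F" using e g(1) by (auto simp: F_def)
      then show False using F\<pi> cE[OF e g(1)] one[OF g] by blast
    qed
    then show ?thesis by (simp add: inj_on_one_iff)
  qed
  have \<pi>E: "(\<lambda>g. \<pi> (\<nu>E e g)) \<in> cont_hom (?A e) Q" if "e \<in> arcs X" for e
    using cont_hom_compose[OF \<nu>E(1)[OF that] \<pi>] .
  have \<pi>V: "(\<lambda>g. \<pi> (\<nu>V v g)) \<in> cont_hom (?B v) Q" if "v \<in> verts X" for v
    using cont_hom_compose[OF \<nu>V(1)[OF that] \<pi>] .
  have injE: "inj_on (\<lambda>g. \<pi> (\<nu>E e g)) (carrier (?A e))" if "e \<in> arcs X" for e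
    using inj[OF that \<pi>E[OF that]] .
  \<comment> \<open>Inside \<open>\<Gamma>\<close> the head embedding is conjugate to
    \<open>\<nu>E e\<close> by \<open>t e\<close>, so the two have the same kernel after
    \<open>\<pi>\<close>.\<close>
  have injH: "inj_on (\<lambda>g. \<pi> (\<nu>V (head X e) (bd1 \<G> e g))) (carrier (?A e))" if e: "e \<in> arcs X" for e
  proof (rule inj[OF e])
    show "(\<lambda>g. \<pi> (\<nu>V (head X e) (bd1 \<G> e g))) \<in> cont_hom (?A e) Q"
      using cont_hom_compose[OF bd(3)[OF e] \<pi>V[OF X.head_in_verts[OF e]]] .
    fix g assume g: "g \<in> carrier (?A e)" "\<pi> (\<nu>V (head X e) (bd1 \<G> e g)) = \<one>\<^bsub>Q\<^esub>"
    have "\<nu>V (head X e) (bd1 \<G> e g) \<in> carrier \<Gamma>" using cV c0(2)[OF e g(1)] e by simp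
    then show "\<pi> (\<nu>E e g) = \<one>\<^bsub>Q\<^esub>" using g \<nu>E(3)[OF e] by (simp add: rel(2)[OF e g(1)] \<pi>g)
  qed
  have injT: "inj_on (\<lambda>g. \<pi> (\<nu>V (tail X e) (bd0 \<G> e g))) (carrier (?A e))" if e: "e \<in> arcs X" for e
    using injE[OF e] rel(1)[OF e] by (simp cong: inj_on_cong)
  have \<pi>eq: "\<pi> (inv\<^bsub>\<Gamma>\<^esub> x \<otimes>\<^bsub>\<Gamma>\<^esub> y) = \<one>\<^bsub>Q\<^esub>" if "\<pi> y = \<pi> x" "x \<in> carrier \<Gamma>" "y \<in> carrier \<Gamma>" for x y
    using that by (simp add: \<pi>g)

  \<comment> \<open>Reciprocal orders of the images\<close>
  define a where "a e = 1 / real (card (\<pi> ` \<nu>E e ` carrier (?A e)))" for e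
  define b where "b v = 1 / real (card (\<pi> ` \<nu>V v ` carrier (?B v)))" for v
  have a: "a e = 1 / real (card (carrier (?A e)))" if "e \<in> arcs X" for e
    using card_image[OF injE[OF that]] by (simp add: a_def image_image)
  have cardA: "card (carrier (?A e)) > 0" if "e \<in> arcs X" for e
    using finA[OF that] Group.group.is_monoid[OF gA[OF that]]
    by (auto simp: card_gt_0_iff intro: monoid.one_closed)
  have Kpos: "K > 0"
  proof -
    obtain e where "e \<in> arcs X" using ne by blast
    then show ?thesis using cardA[of e] cardK[of e] by linarith
  qed
  have pb: "real p * b v \<le> a e"
    if e: "e \<in> arcs X" and le: "p * card (carrier (?A e)) \<le> card (\<pi> ` \<nu>V v ` carrier (?B v))" for e v
  proof -
    have "real p * real (card (carrier (?A e))) \<le> real (card (\<pi> ` \<nu>V v ` carrier (?B v)))"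
      using le by (simp flip: of_nat_mult)
    moreover have "real p * real (card (carrier (?A e))) > 0" using cardA[OF e] p1 by simp
    ultimately show ?thesis using cardA[OF e] by (simp add: a[OF e] b_def field_simps)
  qed

  \<comment> \<open>The upper bound from the rank\<close>
  obtain f where f: "f \<in> top_iso \<Gamma> G" using assms(9) by blast
  obtain S where S: "finite S" "card S = rk G" "top_generates G S" using rk_attained[OF assms(3)] by blast
  obtain S' where S': "top_generates \<Gamma> S'" "bij_betw f S' S"
    using top_generates_top_iso_preimage[OF f pp\<Gamma> assms(2) S(3)] by blast
  have "finite S'" "card S' = rk G"
    using S S'(2) bij_betw_finite bij_betw_same_card by metis+
  with euler_characteristic_bound[OF p \<G> assms(6) \<Gamma> Q \<pi> _ S'(1)]
  have upper: "(\<Sum>e\<in>arcs X. a e) - (\<Sum>v\<in>verts X. b v) \<le> real (rk G) - 1"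
    by (simp add: a_def b_def X_def)

  \<comment> \<open>The lower bound from the number of edges\<close>
  have "(real p - 1) / real p * (1 / real_of_int K) * (real (card (arcs X)) - 1)
      \<le> (\<Sum>e\<in>arcs X. a e) - (\<Sum>v\<in>verts X. b v)"
  proof (rule sum_edge_vertex_bound[OF fin conn ne])
    show "2 \<le> real p" using p1 by simp
    show "0 \<le> 1 / real_of_int K" using Kpos by simp
    fix e assume e: "e \<in> arcs X"
    have "real (card (carrier (?A e))) \<le> real_of_int K" using cardK[OF e] by linarith
    then show "1 / real_of_int K \<le> a e" using cardA[OF e] by (simp add: a[OF e] frac_le)
    \<comment> \<open>For every edge, loops included, the edge group sits in the tail group; this
      gives the comparison without the factor p.\<close>
    have "\<pi> ` \<nu>E e ` carrier (?A e) \<subseteq> \<pi> ` \<nu>V (tail X e) ` carrier (?B (tail X e))"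
      using rel(1)[OF e] c0(1)[OF e] by (metis (no_types, lifting) image_mono image_subsetI rev_image_eqI)
    moreover have "finite (\<pi> ` \<nu>V (tail X e) ` carrier (?B (tail X e)))"
      using order_pro_p_group_discrete(1)[OF p Q] cont_homD(1)[OF \<pi>V[OF X.tail_in_verts[OF e]]]
      by (auto simp: image_image intro: finite_subset[of _ "carrier Q"])
    ultimately have "card (\<pi> ` \<nu>E e ` carrier (?A e)) \<le> card (\<pi> ` \<nu>V (tail X e) ` carrier (?B (tail X e)))"
      by (intro card_mono)
    moreover have "card (\<pi> ` \<nu>E e ` carrier (?A e)) > 0"
      using card_image[OF injE[OF e]] cardA[OF e] by (simp add: image_image)
    ultimately show "b (tail X e) \<le> a e" by (simp add: a_def b_def frac_le)
    assume "tail X e \<noteq> head X e"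
    then have e': "e \<in> E'" using e by (simp add: E'_def)
    note v = E'[OF e']
    have "p * card (carrier (?A e)) \<le> card ((\<lambda>g. \<pi> (\<nu>V (tail X e) g)) ` carrier (?B (tail X e)))"
    proof (rule card_proper_image[OF p Q gA[OF e] gB[OF v(2)] bd(1)[OF e] \<pi>V[OF v(2)] injT[OF e]])
      show "y0 e \<in> carrier (?B (tail X e))" using y0[OF e'] by simp
      fix g assume g: "g \<in> carrier (?A e)"
      have cl: "\<nu>V (tail X e) (bd0 \<G> e g) \<in> carrier \<Gamma>" "\<nu>V (tail X e) (y0 e) \<in> carrier \<Gamma>"
        using cV[OF v(2)] c0(1)[OF e g] y0[OF e'] by auto
      \<comment> \<open>With these quotients in \<open>F\<close>, \<open>\<pi>\<close> cannot merge
        \<open>y0 e\<close> with an element of the edge group.\<close>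
      have "inv\<^bsub>\<Gamma>\<^esub> (\<nu>V (tail X e) (bd0 \<G> e g)) \<otimes>\<^bsub>\<Gamma>\<^esub> \<nu>V (tail X e) (y0 e) \<in> F"
        unfolding F_def using e' g by blast
      then show "\<pi> (\<nu>V (tail X e) (y0 e)) \<noteq> \<pi> (\<nu>V (tail X e) (bd0 \<G> e g))"
        using F\<pi> \<pi>eq[OF _ cl] cl by (meson \<Gamma>.inv_closed \<Gamma>.m_closed)
    qed
    moreover have "p * card (carrier (?A e)) \<le> card ((\<lambda>g. \<pi> (\<nu>V (head X e) g)) ` carrier (?B (head X e)))"
    proof (rule card_proper_image[OF p Q gA[OF e] gB[OF v(3)] bd(3)[OF e] \<pi>V[OF v(3)] injH[OF e]])
      show "y1 e \<in> carrier (?B (head X e))" using y1[OF e'] by simp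
      fix g assume g: "g \<in> carrier (?A e)"
      have cl: "\<nu>V (head X e) (bd1 \<G> e g) \<in> carrier \<Gamma>" "\<nu>V (head X e) (y1 e) \<in> carrier \<Gamma>"
        using cV[OF v(3)] c0(2)[OF e g] y1[OF e'] by auto
      have "inv\<^bsub>\<Gamma>\<^esub> (\<nu>V (head X e) (bd1 \<G> e g)) \<otimes>\<^bsub>\<Gamma>\<^esub> \<nu>V (head X e) (y1 e) \<in> F"
        unfolding F_def using e' g by blast
      then show "\<pi> (\<nu>V (head X e) (y1 e)) \<noteq> \<pi> (\<nu>V (head X e) (bd1 \<G> e g))"
        using F\<pi> \<pi>eq[OF _ cl] cl by (meson \<Gamma>.inv_closed \<Gamma>.m_closed)
    qed
    ultimately show "real p * b (tail X e) \<le> a e \<and> real p * b (head X e) \<le> a e"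
      using pb[OF e] by (simp add: image_image)
  qed
  then have "(real p - 1) / real p * (1 / real_of_int K) * (real (card (arcs X)) - 1) \<le> real (rk G) - 1"
    using upper by linarith
  moreover have "real p > 1" "real_of_int K > 0" using p1 Kpos by auto
  ultimately have "real (card (arcs X)) - 1 \<le> real p * real_of_int K / (real p - 1) * (real (rk G) - 1)"
    by (simp add: field_simps)
  then show ?thesis by (simp add: X_def)
qed

end
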